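(* Let $N\geq 3$, let $\Omega\subset\mathbb{R}^N$ be a bounded smooth starshaped domain, and let $\vartheta:\mathbb{R}\to[1,\infty)$ be an even $C^1$ function such that: $\vartheta$ is decreasing in $(-\infty,0)$ and increasing in $(0,\infty)$; $s\mapsto\vartheta(s)/s^2$ is nondecreasing in $(-\infty,0)$ and nonincreasing in $(0,\infty)$; and $\lim_{|s|\to\infty}\vartheta(s)/s^2=\alpha^2/2$ for some $\alpha>0$. Let $q\in[2\cdot 2^*-1,\infty)$, where $2^*=2N/(N-2)$. Then, for every $\lambda\in\mathbb{R}$, the problem $$-\mathrm{div}(\vartheta(u)\nabla u)+\tfrac12\vartheta'(u)|\nabla u|^2=\lambda|u|^{q-1}u \ \text{ in } \Omega,\qquad u=0 \ \text{ on } \partial\Omega$$ has no positive solution.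
   Context: "Increasing"/"decreasing" are meant strictly. A solution is a weak solution: $u\in C^1(\overline\Omega)$ with $u=0$ on $\partial\Omega$ and $\int_\Omega\vartheta(u)\nabla u\cdot\nabla\varphi\,dx+\frac12\int_\Omega\vartheta'(u)|\nabla u|^2\varphi\,dx=\lambda\int_\Omega|u|^{q-1}u\varphi\,dx$ for all $\varphi\in H_0^1(\Omega)$. It is positive if $u>0$ in $\Omega$. *)

theory Defs
  imports "HOL-Analysis.Analysis"
begin

definition grad :: "('a::euclidean_space \<Rightarrow> real) \<Rightarrow> 'a \<Rightarrow> 'a" where
  "grad f x = (THE D. GDERIV f x :> D)"

text \<open>Meant for open \<open>S\<close>. The derivative of order \<open>k\<close> is accessed through iterated directional
  derivatives, so that the recursion stays within one type.\<close>

primrec Ck_on :: "nat \<Rightarrow> 'a::euclidean_space set \<Rightarrow> ('a \<Rightarrow> real) \<Rightarrow> bool" where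
  "Ck_on 0 S f \<longleftrightarrow> continuous_on S f"
| "Ck_on (Suc k) S f \<longleftrightarrow> (\<forall>x\<in>S. f differentiable (at x)) \<and>
     (\<forall>v. Ck_on k S (\<lambda>x. frechet_derivative f (at x) v))"

definition smooth_on :: "'a::euclidean_space set \<Rightarrow> ('a \<Rightarrow> real) \<Rightarrow> bool" where
  "smooth_on S f \<longleftrightarrow> (\<forall>k. Ck_on k S f)"

text \<open>Near each boundary point, the set is the part of a ball lying strictly above the graph of a
  smooth function. The unit vector \<open>e\<close> is the last axis of a rotated coordinate system, and
  \<open>x - (x \<bullet> e) *\<^sub>R e\<close> collects the remaining coordinates of \<open>x\<close>; only the values of \<open>\<gamma>\<close> on the
  hyperplane orthogonal to \<open>e\<close> matter.\<close>

definition smooth_boundary :: "'a::euclidean_space set \<Rightarrow> bool" where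
  "smooth_boundary \<Omega> \<longleftrightarrow>
     (\<forall>x0\<in>frontier \<Omega>. \<exists>r>0. \<exists>e \<gamma>. norm e = 1 \<and> smooth_on UNIV \<gamma> \<and>
        \<Omega> \<inter> ball x0 r = {x \<in> ball x0 r. x \<bullet> e > \<gamma> (x - (x \<bullet> e) *\<^sub>R e)})"

definition smooth_domain :: "'a::euclidean_space set \<Rightarrow> bool" where
  "smooth_domain \<Omega> \<longleftrightarrow> open \<Omega> \<and> connected \<Omega> \<and> \<Omega> \<noteq> {} \<and> smooth_boundary \<Omega>"

definition test_function :: "'a::euclidean_space set \<Rightarrow> ('a \<Rightarrow> real) \<Rightarrow> bool" where
  "test_function \<Omega> \<psi> \<longleftrightarrow> smooth_on UNIV \<psi> \<and>
     compact (closure {x. \<psi> x \<noteq> 0}) \<and> closure {x. \<psi> x \<noteq> 0} \<subseteq> \<Omega>"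

definition in_L2 :: "'a::euclidean_space set \<Rightarrow> ('a \<Rightarrow> 'b::euclidean_space) \<Rightarrow> bool" where
  "in_L2 \<Omega> f \<longleftrightarrow> set_borel_measurable lebesgue \<Omega> f \<and>
     set_integrable lebesgue \<Omega> (\<lambda>x. (norm (f x))\<^sup>2)"

definition weak_gradient :: "'a::euclidean_space set \<Rightarrow> ('a \<Rightarrow> real) \<Rightarrow> ('a \<Rightarrow> 'a) \<Rightarrow> bool" where
  "weak_gradient \<Omega> \<phi> G \<longleftrightarrow> (\<forall>\<psi>. test_function \<Omega> \<psi> \<longrightarrow>
     (LINT x:\<Omega>|lebesgue. \<phi> x *\<^sub>R grad \<psi> x) = - (LINT x:\<Omega>|lebesgue. \<psi> x *\<^sub>R G x))"

text \<open>The Sobolev spaces are given as relations between a function and a representative of its weak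
  gradient, which is determined only up to null sets.\<close>

definition in_H1 :: "'a::euclidean_space set \<Rightarrow> ('a \<Rightarrow> real) \<Rightarrow> ('a \<Rightarrow> 'a) \<Rightarrow> bool" where
  "in_H1 \<Omega> \<phi> G \<longleftrightarrow> in_L2 \<Omega> \<phi> \<and> in_L2 \<Omega> G \<and> weak_gradient \<Omega> \<phi> G"

definition in_H10 :: "'a::euclidean_space set \<Rightarrow> ('a \<Rightarrow> real) \<Rightarrow> ('a \<Rightarrow> 'a) \<Rightarrow> bool" where
  "in_H10 \<Omega> \<phi> G \<longleftrightarrow> in_H1 \<Omega> \<phi> G \<and>
     (\<exists>\<psi>. (\<forall>k::nat. test_function \<Omega> (\<psi> k)) \<and>
        (\<lambda>k. (LINT x:\<Omega>|lebesgue. (\<psi> k x - \<phi> x)\<^sup>2)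
            + (LINT x:\<Omega>|lebesgue. (norm (grad (\<psi> k) x - G x))\<^sup>2)) \<longlonglongrightarrow> 0)"

definition C1_closure :: "'a::euclidean_space set \<Rightarrow> ('a \<Rightarrow> real) \<Rightarrow> bool" where
  "C1_closure \<Omega> u \<longleftrightarrow> continuous_on (closure \<Omega>) u \<and>
     (\<exists>D. continuous_on (closure \<Omega>) D \<and> (\<forall>x\<in>\<Omega>. GDERIV u x :> D x))"

definition weak_solution ::
  "(real \<Rightarrow> real) \<Rightarrow> real \<Rightarrow> real \<Rightarrow> 'a::euclidean_space set \<Rightarrow> ('a \<Rightarrow> real) \<Rightarrow> bool" where
  "weak_solution \<theta> q lam \<Omega> u \<longleftrightarrow> C1_closure \<Omega> u \<and> (\<forall>x\<in>frontier \<Omega>. u x = 0) \<and>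
     (\<forall>\<phi> G. in_H10 \<Omega> \<phi> G \<longrightarrow>
        (LINT x:\<Omega>|lebesgue. \<theta> (u x) * (grad u x \<bullet> G x))
        + 1/2 * (LINT x:\<Omega>|lebesgue. deriv \<theta> (u x) * (norm (grad u x))\<^sup>2 * \<phi> x)
        = lam * (LINT x:\<Omega>|lebesgue. \<bar>u x\<bar> powr (q - 1) * u x * \<phi> x))"

definition positive_in :: "'a set \<Rightarrow> ('a \<Rightarrow> real) \<Rightarrow> bool" where
  "positive_in \<Omega> u \<longleftrightarrow> (\<forall>x\<in>\<Omega>. u x > 0)"

definition critical_exponent :: "nat \<Rightarrow> real" where
  "critical_exponent N = 2 * real N / (real N - 2)"

end

theory Submission
  imports Defs
begin

text \<open>The primitive \<open>\<Theta>\<close> of \<open>sqrt \<theta>\<close> turns the equation into a semilinear one: \<open>v = \<Theta>(u)\<close> satisfies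
\<open>- \<Delta> v = \<lambda> u\<^sup>q / sqrt (\<theta> u)\<close> weakly, and the nonlinearity has the primitive \<open>u\<^sup>q\<^sup>+\<^sup>1 / (q + 1)\<close> in the variable
\<open>v\<close>. For a starlike domain, Pohozaev's identity gives

  \<open>(N - 2) / 2 \<integral> |\<nabla>v|\<^sup>2 \<le> \<lambda> N / (q + 1) \<integral> u\<^sup>q\<^sup>+\<^sup>1\<close>,

while testing with \<open>v\<close> gives \<open>\<integral> |\<nabla>v|\<^sup>2 = \<lambda> \<integral> u\<^sup>q \<Theta>(u) / sqrt (\<theta> u)\<close>, so that \<open>\<lambda> > 0\<close>. Monotonicity of
\<open>\<theta>(s) / s\<^sup>2\<close> yields \<open>\<Theta>(s) > s sqrt (\<theta> s) / 2\<close>. Together these force \<open>(N - 2) / 4 < N / (q + 1)\<close>, which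
contradicts \<open>q + 1 \<ge> 4 N / (N - 2)\<close>.

The solution is merely \<open>C\<^sup>1\<close> up to the boundary, which rules out multiplying the equation by
\<open>x \<bullet> \<nabla>v\<close> and integrating by parts directly. Instead, the lemma \<open>pohozaev_inequality\<close> tests with the
difference \<open>v(a + t (x - a)) - v(x)\<close> for \<open>t > 1\<close>, which is admissible because the domain is starlike about \<open>a\<close>,
and lets \<open>t\<close> tend to one. Only first derivatives of \<open>v\<close> occur, and no boundary integral does.

What remains is to admit such test functions. The lemma \<open>C1_compact_support_in_H10\<close> places
continuously differentiable functions with compact support in the Sobolev space by mollification, and
\<open>semilinear_identity\<close> reaches functions that merely vanish off a subset of the domain by truncating
them near zero and passing to the limit.\<close>

section \<open>Smooth bumps and convolution\<close>

text \<open>For \<open>s > 0\<close> this is \<open>exp (- 1 / s) / s ^ k\<close>. The negative powers are there because they make the family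
closed under differentiation up to linear combinations.\<close>

definition flat_exp :: "nat \<Rightarrow> real \<Rightarrow> real" where
  "flat_exp k s = (if s > 0 then exp (- inverse s) * inverse s ^ k else 0)"

lemma flat_exp_tendsto_0: "(flat_exp k \<longlongrightarrow> 0) (at 0)"
proof -
  have "((\<lambda>s. inverse s ^ k / exp (inverse s)) \<longlongrightarrow> 0) (at_right (0::real))"
    by (rule filterlim_compose[OF tendsto_power_div_exp_0 filterlim_inverse_at_top_right])
  moreover have "\<forall>\<^sub>F s in at_right 0. inverse s ^ k / exp (inverse s) = flat_exp k s"
    by (auto simp: eventually_at_filter flat_exp_def exp_minus field_simps)
  ultimately have "(flat_exp k \<longlongrightarrow> 0) (at_right 0)"
    by (rule Lim_transform_eventually)
  moreover have "(flat_exp k \<longlongrightarrow> 0) (at_left 0)"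
    by (rule Lim_transform_eventually[OF tendsto_const])
      (auto simp: eventually_at_filter flat_exp_def)
  ultimately show ?thesis
    by (simp add: filterlim_at_split)
qed

lemma DERIV_flat_exp:
  "(flat_exp k has_real_derivative flat_exp (k + 2) s - real k * flat_exp (k + 1) s) (at s)"
proof (cases s "0::real" rule: linorder_cases)
  case less
  have "((\<lambda>_. 0) has_real_derivative 0) (at s)" by simp
  then have "(flat_exp k has_real_derivative 0) (at s)"
    by (rule has_field_derivative_transform_within_open[where S="{..<0}"])
      (use less in \<open>auto simp: flat_exp_def\<close>)
  with less show ?thesis by (simp add: flat_exp_def)
next
  case equal
  have "((\<lambda>h. flat_exp (Suc k) h) \<longlongrightarrow> 0) (at 0)" by (rule flat_exp_tendsto_0)
  moreover have "\<forall>\<^sub>F h in at 0. flat_exp (Suc k) h = (flat_exp k (0 + h) - flat_exp k 0) / h"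
    by (auto simp: flat_exp_def divide_inverse eventually_at_filter)
  ultimately have "((\<lambda>h. (flat_exp k (0 + h) - flat_exp k 0) / h) \<longlongrightarrow> 0) (at 0)"
    by (rule Lim_transform_eventually)
  then have "(flat_exp k has_real_derivative 0) (at 0)" by (simp add: DERIV_def)
  with equal show ?thesis by (simp add: flat_exp_def)
next
  case greater
  have "((\<lambda>s. exp (- inverse s) * inverse s ^ k) has_real_derivative
      flat_exp (k + 2) s - real k * flat_exp (k + 1) s) (at s)"
    using greater
    by (auto intro!: derivative_eq_intros simp: flat_exp_def)
      (cases k; auto simp: field_simps power2_eq_square)
  then show ?thesis
    by (rule has_field_derivative_transform_within_open[where S="{0<..}"])
      (use greater in \<open>auto simp: flat_exp_def\<close>)
qed

text \<open>Smoothness is an infinite conjunction over the order \<open>k\<close>, so it is proved coinductively: a class of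
differentiable functions that contains the directional derivatives of its members consists of smooth
functions.\<close>

lemma Ck_on_UNIV_coinduct:
  assumes "P f"
    and step: "\<And>f. P f \<Longrightarrow> \<exists>f'. (\<forall>x. (f has_derivative f' x) (at x)) \<and> (\<forall>v. P (\<lambda>x. f' x v))"
  shows "Ck_on k UNIV f"
  using assms(1)
proof (induction k arbitrary: f)
  case 0
  obtain f' where "\<forall>x. (f has_derivative f' x) (at x)"
    using step[OF 0] by (elim exE conjE)
  then show ?case
    using has_derivative_continuous_on[of UNIV f f'] by simp
next
  case (Suc k)
  obtain f' where f': "\<forall>x. (f has_derivative f' x) (at x)" "\<forall>v. P (\<lambda>x. f' x v)"
    using step[OF Suc.prems] by (elim exE conjE)
  have "frechet_derivative f (at x) = f' x" for x
    using frechet_derivative_at[OF f'(1)[rule_format, of x]] by simp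
  moreover have "Ck_on k UNIV (\<lambda>x. f' x v)" for v
    using Suc.IH f'(2) by simp
  moreover have "f differentiable (at x)" for x
    using f'(1) unfolding differentiable_def by blast
  ultimately show ?case by simp
qed

lemma smooth_on_UNIV_derivative:
  assumes "smooth_on UNIV f"
  shows "(f has_derivative frechet_derivative f (at x)) (at x)"
    and "smooth_on UNIV (\<lambda>x. frechet_derivative f (at x) v)"
    and "continuous_on UNIV f"
proof -
  have "Ck_on (Suc k) UNIV f" for k
    using assms unfolding smooth_on_def by blast
  then show "(f has_derivative frechet_derivative f (at x)) (at x)"
    and "smooth_on UNIV (\<lambda>x. frechet_derivative f (at x) v)"
    by (auto simp: smooth_on_def frechet_derivative_works[symmetric])
  have "Ck_on 0 UNIV f" using assms unfolding smooth_on_def by blast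
  then show "continuous_on UNIV f" by simp
qed

text \<open>An explicit class that contains the bump \<open>flat_exp 0 (c - x \<bullet> x)\<close> and that the product and chain rules
visibly map into itself; it serves as the invariant in the coinduction above.\<close>

inductive bump_algebra :: "real \<Rightarrow> ('a::euclidean_space \<Rightarrow> real) \<Rightarrow> bool" for c where
  const: "bump_algebra c (\<lambda>x. r)"
| inner: "bump_algebra c (\<lambda>x. x \<bullet> v)"
| add: "bump_algebra c f \<Longrightarrow> bump_algebra c g \<Longrightarrow> bump_algebra c (\<lambda>x. f x + g x)"
| mult: "bump_algebra c f \<Longrightarrow> bump_algebra c g \<Longrightarrow> bump_algebra c (\<lambda>x. f x * g x)"
| bump: "bump_algebra c (\<lambda>x. flat_exp k (c - x \<bullet> x))"

lemma bump_algebra_derivative: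
  assumes "bump_algebra c f"
  shows "\<exists>f'. (\<forall>x. (f has_derivative f' x) (at x)) \<and> (\<forall>v. bump_algebra c (\<lambda>x. f' x v))"
  using assms
proof induction
  case (const r)
  then show ?case by (intro exI[of _ "\<lambda>_ _. 0"]) (auto intro: bump_algebra.intros)
next
  case (inner v)
  show ?case
    by (intro exI[of _ "\<lambda>_ h. h \<bullet> v"])
      (auto intro!: derivative_eq_intros bump_algebra.const)
next
  case (add f g)
  then obtain f' g' where "\<And>x. (f has_derivative f' x) (at x)" "\<And>v. bump_algebra c (\<lambda>x. f' x v)"
    "\<And>x. (g has_derivative g' x) (at x)" "\<And>v. bump_algebra c (\<lambda>x. g' x v)" by blast
  then show ?case
    by (intro exI[of _ "\<lambda>x h. f' x h + g' x h"])
      (intro conjI allI has_derivative_add bump_algebra.add)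
next
  case (mult f g)
  then obtain f' g' where "\<And>x. (f has_derivative f' x) (at x)" "\<And>v. bump_algebra c (\<lambda>x. f' x v)"
    "\<And>x. (g has_derivative g' x) (at x)" "\<And>v. bump_algebra c (\<lambda>x. g' x v)" by blast
  with mult.hyps show ?case
    by (intro exI[of _ "\<lambda>x h. f x * g' x h + f' x h * g x"])
      (intro conjI allI has_derivative_mult bump_algebra.add bump_algebra.mult)
next
  case (bump k)
  define d where "d s = flat_exp (k + 2) s + (- real k) * flat_exp (k + 1) s" for s
  have "(flat_exp k has_derivative (\<lambda>h. h * d s)) (at s)" for s
    using DERIV_flat_exp[of k s]
    by (simp add: has_field_derivative_def d_def mult_commute_abs)
  then have "((\<lambda>x::'a. flat_exp k (c - x \<bullet> x)) has_derivative
      (\<lambda>h. (- (x \<bullet> h + h \<bullet> x)) * d (c - x \<bullet> x))) (at x)" for x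
    by (rule has_derivative_compose[rotated]) (auto intro!: derivative_eq_intros)
  moreover have "- (x \<bullet> h + h \<bullet> x) = (- 2) * (x \<bullet> h)" for x h :: 'a
    by (simp add: inner_commute)
  ultimately have der: "((\<lambda>x::'a. flat_exp k (c - x \<bullet> x)) has_derivative
      (\<lambda>h. ((- 2) * (x \<bullet> h)) * d (c - x \<bullet> x))) (at x)" for x
    by (simp only:)
  have "bump_algebra c (\<lambda>x::'a. flat_exp (k + 2) (c - x \<bullet> x) + (- real k) * flat_exp (k + 1) (c - x \<bullet> x))"
    by (rule bump_algebra.add[OF bump_algebra.bump
          bump_algebra.mult[OF bump_algebra.const bump_algebra.bump]])
  moreover have "bump_algebra c (\<lambda>x::'a. (- 2) * (x \<bullet> v))" for v
    by (rule bump_algebra.mult[OF bump_algebra.const bump_algebra.inner])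
  ultimately have alg: "bump_algebra c (\<lambda>x::'a. ((- 2) * (x \<bullet> v)) * d (c - x \<bullet> x))" for v
    unfolding d_def by (rule bump_algebra.mult[rotated])
  show ?case
    using der alg by (intro exI[of _ "\<lambda>x h. ((- 2) * (x \<bullet> h)) * d (c - x \<bullet> x)"]) simp
qed

lemma smooth_on_bump_algebra:
  assumes "bump_algebra c f"
  shows "smooth_on UNIV f"
  unfolding smooth_on_def
  by (intro allI Ck_on_UNIV_coinduct[where P="bump_algebra c", OF assms bump_algebra_derivative])

lemma integral_pos_on_open:
  fixes f :: "'a::euclidean_space \<Rightarrow> real"
  assumes int: "integrable lborel f" and nn: "\<And>x. f x \<ge> 0"
    and S: "open S" "S \<noteq> {}" and pos: "\<And>x. x \<in> S \<Longrightarrow> f x > 0"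
  shows "(LINT x|lborel. f x) > 0"
proof -
  have "(LINT x|lborel. f x) \<noteq> 0"
  proof
    assume "(LINT x|lborel. f x) = 0"
    then have "AE x in lborel. f x = 0"
      using integral_nonneg_eq_0_iff_AE[OF int] nn by (meson AE_I2)
    then have "AE x in lborel. x \<notin> S"
      by eventually_elim (metis less_irrefl pos)
    then have "S \<in> null_sets lborel"
      using S(1) by (subst AE_iff_null_sets) auto
    then have "negligible S"
      by (auto simp: negligible_iff_null_sets intro: null_sets_completionI)
    with S show False using open_not_negligible by blast
  qed
  moreover have "(LINT x|lborel. f x) \<ge> 0" using nn by simp
  ultimately show ?thesis by linarith
qed

lemma smooth_bump_exists:
  assumes "d > 0"
  obtains \<kappa> :: "'a::euclidean_space \<Rightarrow> real" where "smooth_on UNIV \<kappa>" "\<And>x. \<kappa> x \<ge> 0"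
    "\<And>x. norm x \<ge> d \<Longrightarrow> \<kappa> x = 0" "integrable lborel \<kappa>" "(LINT x|lborel. \<kappa> x) = 1"
proof -
  define b where "b x = flat_exp 0 (d\<^sup>2 - x \<bullet> x)" for x :: 'a
  have b: "bump_algebra (d\<^sup>2) b"
    unfolding b_def[abs_def] by (rule bump_algebra.bump)
  have cont: "continuous_on UNIV b"
    using smooth_on_UNIV_derivative(3)[OF smooth_on_bump_algebra[OF b]] .
  have b0: "b x = 0" if "norm x \<ge> d" for x
  proof -
    have "d\<^sup>2 \<le> (norm x)\<^sup>2" using that assms by (intro power_mono) auto
    then show ?thesis by (simp add: b_def flat_exp_def dot_square_norm not_less)
  qed
  have bpos: "b x > 0" if "norm x < d" for x
  proof -
    have "(norm x)\<^sup>2 < d\<^sup>2" using that by (intro power_strict_mono) auto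
    then show ?thesis by (simp add: b_def flat_exp_def dot_square_norm)
  qed
  have nn: "b x \<ge> 0" for x by (simp add: b_def flat_exp_def)
  have "integrable lborel (\<lambda>x. indicator (cball 0 d) x *\<^sub>R b x)"
    by (rule borel_integrable_compact) (auto intro: continuous_on_subset[OF cont])
  also have "(\<lambda>x. indicator (cball 0 d) x *\<^sub>R b x) = b"
    using b0 by (auto simp: indicator_def fun_eq_iff)
  finally have int: "integrable lborel b" .
  have pos: "(LINT x|lborel. b x) > 0"
    by (rule integral_pos_on_open[OF int nn, of "ball 0 d"]) (use bpos assms in auto)
  show thesis
  proof
    let ?c = "inverse (LINT x|lborel. b x)"
    show "smooth_on UNIV (\<lambda>x. ?c * b x)"
      by (rule smooth_on_bump_algebra[OF bump_algebra.mult[OF bump_algebra.const b]])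
    show "?c * b x \<ge> 0" for x using nn pos by simp
    show "?c * b x = 0" if "norm x \<ge> d" for x using b0 that by simp
    show "integrable lborel (\<lambda>x. ?c * b x)" using int by simp
    show "(LINT x|lborel. ?c * b x) = 1" using pos by simp
  qed
qed

text \<open>Leibniz's rule needs the derivative as a continuous family of bounded linear maps. It is assembled
from the directional derivatives along the basis vectors.\<close>

lemma has_derivative_convolution:
  fixes \<phi> \<kappa> :: "'a::euclidean_space \<Rightarrow> real"
  assumes \<phi>: "continuous_on UNIV \<phi>"
    and \<kappa>: "\<And>x. (\<kappa> has_derivative \<kappa>' x) (at x)"
    and \<kappa>': "\<And>v. continuous_on UNIV (\<lambda>x. \<kappa>' x v)"
  shows "((\<lambda>x. integral (cbox a b) (\<lambda>y. \<phi> y * \<kappa> (x - y))) has_derivative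
     (\<lambda>v. integral (cbox a b) (\<lambda>y. \<phi> y * \<kappa>' (x - y) v))) (at x)"
proof -
  define F where
    "F x y = (\<Sum>i\<in>Basis. (\<phi> y * \<kappa>' (x - y) i) *\<^sub>R blinfun_inner_left i)" for x y :: 'a
  have F: "blinfun_apply (F x y) = (\<lambda>h. \<phi> y * \<kappa>' (x - y) h)" for x y
  proof
    fix h
    interpret bounded_linear "\<kappa>' (x - y)" using \<kappa> by (rule has_derivative_bounded_linear)
    have "\<kappa>' (x - y) h = \<kappa>' (x - y) (\<Sum>i\<in>Basis. (h \<bullet> i) *\<^sub>R i)"
      by (simp add: euclidean_representation)
    also have "\<dots> = (\<Sum>i\<in>Basis. (h \<bullet> i) * \<kappa>' (x - y) i)"
      by (simp add: sum scaleR)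
    finally show "blinfun_apply (F x y) h = \<phi> y * \<kappa>' (x - y) h"
      by (simp add: F_def blinfun.sum_left blinfun.scaleR_left sum_distrib_left algebra_simps)
  qed
  have cont\<kappa>: "continuous_on UNIV \<kappa>"
    using \<kappa> has_derivative_continuous_on[of UNIV \<kappa> \<kappa>'] by simp
  have contF: "continuous_on (UNIV \<times> cbox a b) (\<lambda>(x, y). F x y)"
    unfolding F_def case_prod_beta
    by (intro continuous_intros continuous_on_compose2[OF \<phi>] continuous_on_compose2[OF \<kappa>']) auto
  have contF2: "continuous_on (cbox a b) (F x)" for x
    unfolding F_def
    by (intro continuous_intros continuous_on_compose2[OF \<phi>] continuous_on_compose2[OF \<kappa>']) auto
  have "((\<lambda>x. integral (cbox a b) (\<lambda>y. \<phi> y * \<kappa> (x - y))) has_derivative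
      integral (cbox a b) (F x)) (at x within UNIV)"
  proof (rule leibniz_rule[OF _ _ contF])
    show "((\<lambda>x. \<phi> t * \<kappa> (x - t)) has_derivative blinfun_apply (F x t)) (at x within UNIV)" for x t
      unfolding F
      by (auto intro!: derivative_eq_intros has_derivative_compose[OF _ \<kappa>, where f="\<lambda>x. x - t"])
    show "(\<lambda>y. \<phi> y * \<kappa> (x - y)) integrable_on cbox a b" for x
      by (intro integrable_continuous continuous_intros continuous_on_compose2[OF \<phi>]
          continuous_on_compose2[OF cont\<kappa>]) auto
  qed auto
  moreover have "blinfun_apply (integral (cbox a b) (F x))
      = (\<lambda>v. integral (cbox a b) (\<lambda>y. \<phi> y * \<kappa>' (x - y) v))"
    by (simp add: fun_eq_iff blinfun_apply_integral[OF integrable_continuous[OF contF2]] F)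
  ultimately show ?thesis by simp
qed

text \<open>A directional derivative of a convolution falls on the smooth factor and is again a convolution of
\<open>\<phi>\<close> with a smooth function. Hence convolutions with a fixed continuous \<open>\<phi>\<close> form a class to which the
coinduction applies.\<close>

lemma smooth_on_convolution:
  fixes \<phi> \<kappa> :: "'a::euclidean_space \<Rightarrow> real"
  assumes \<phi>: "continuous_on UNIV \<phi>" and "smooth_on UNIV \<kappa>"
  shows "smooth_on UNIV (\<lambda>x. integral (cbox a b) (\<lambda>y. \<phi> y * \<kappa> (x - y)))"
  unfolding smooth_on_def
proof
  fix k
  let ?P = "\<lambda>f. \<exists>\<kappa>. smooth_on UNIV \<kappa> \<and> f = (\<lambda>x. integral (cbox a b) (\<lambda>y. \<phi> y * \<kappa> (x - y)))"
  show "Ck_on k UNIV (\<lambda>x. integral (cbox a b) (\<lambda>y. \<phi> y * \<kappa> (x - y)))"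
  proof (rule Ck_on_UNIV_coinduct[where P="?P"])
    show "?P (\<lambda>x. integral (cbox a b) (\<lambda>y. \<phi> y * \<kappa> (x - y)))"
      using assms by blast
    fix f assume "?P f"
    then obtain \<kappa> where \<kappa>: "smooth_on UNIV \<kappa>"
      and f: "f = (\<lambda>x. integral (cbox a b) (\<lambda>y. \<phi> y * \<kappa> (x - y)))" by blast
    note d = smooth_on_UNIV_derivative[OF \<kappa>]
    have "(f has_derivative
        (\<lambda>v. integral (cbox a b) (\<lambda>y. \<phi> y * frechet_derivative \<kappa> (at (x - y)) v))) (at x)" for x
      unfolding f
      by (rule has_derivative_convolution[OF \<phi> d(1)])
        (rule smooth_on_UNIV_derivative(3)[OF d(2)])
    then show "\<exists>f'. (\<forall>x. (f has_derivative f' x) (at x)) \<and> (\<forall>v. ?P (\<lambda>x. f' x v))"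
      using d(2)
      by (intro exI[of _ "\<lambda>x v. integral (cbox a b)
        (\<lambda>y. \<phi> y * frechet_derivative \<kappa> (at (x - y)) v)"]) blast
  qed
qed

section \<open>Integrals of bounded functions with bounded support\<close>

text \<open>Every integrand below is bounded, Borel and vanishes off a bounded set. Bundling the three properties
makes integrability a closure computation.\<close>

definition tame :: "('a::euclidean_space \<Rightarrow> 'b::euclidean_space) \<Rightarrow> bool" where
  "tame f \<longleftrightarrow> f \<in> borel_measurable borel \<and> bounded (range f) \<and> bounded {x. f x \<noteq> 0}"

lemma tameI:
  assumes "f \<in> borel_measurable borel" "\<And>x. norm (f x) \<le> C" "bounded S" "\<And>x. x \<notin> S \<Longrightarrow> f x = 0"
  shows "tame f"
  unfolding tame_def
proof (intro conjI)
  show "bounded (range f)" by (rule boundedI[of _ C]) (use assms(2) in blast)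
  show "bounded {x. f x \<noteq> 0}" using assms(3,4) by (metis (mono_tags, lifting) bounded_subset mem_Collect_eq subsetI)
qed fact

lemma tame_measurable: "tame f \<Longrightarrow> f \<in> borel_measurable borel"
  by (simp add: tame_def)

lemma tame_bound: "tame f \<Longrightarrow> \<exists>C\<ge>0. \<forall>x. norm (f x) \<le> C"
  unfolding tame_def bounded_iff by (metis UNIV_I image_eqI norm_ge_zero order_trans)

lemma tame_integrable:
  assumes "tame f" shows "integrable lborel f"
proof -
  obtain C where "\<forall>x. norm (f x) \<le> C" using tame_bound[OF assms] by blast
  then have C: "norm (f x) \<le> C" for x by blast
  have "bounded {x. f x \<noteq> 0}" using assms by (simp add: tame_def)
  then obtain R where R: "\<And>x. f x \<noteq> 0 \<Longrightarrow> norm x \<le> R" unfolding bounded_iff by blast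
  show ?thesis
  proof (rule integrableI_bounded_set)
    show "f \<in> borel_measurable lborel" using assms by (simp add: tame_def)
    show "emeasure lborel (cball 0 R) < \<infinity>" by (rule emeasure_lborel_cball_finite)
    show "AE x in lborel. x \<in> cball 0 R \<longrightarrow> norm (f x) \<le> C" using C by simp
    show "AE x in lborel. x \<notin> cball 0 R \<longrightarrow> f x = 0" using R by (intro AE_I2) auto
  qed simp
qed

text \<open>Boundedness of the combination comes from compactness of the product of the closed ranges, so that mere
continuity of \<open>op\<close> suffices.\<close>

lemma tame_combine:
  fixes op :: "'b::euclidean_space \<Rightarrow> 'c::euclidean_space \<Rightarrow> 'd::euclidean_space"
  assumes "tame f" "tame g" "continuous_on UNIV (\<lambda>p. op (fst p) (snd p))" "op 0 0 = 0"
  shows "tame (\<lambda>x. op (f x) (g x))"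
  unfolding tame_def
proof (intro conjI)
  have "(\<lambda>x. (f x, g x)) \<in> borel_measurable borel"
    using assms(1,2) by (auto simp: tame_def)
  from borel_measurable_continuous_on[OF assms(3) this]
  show "(\<lambda>x. op (f x) (g x)) \<in> borel_measurable borel" unfolding fst_conv snd_conv .
  have "compact (closure (range f) \<times> closure (range g))"
    using assms(1,2) by (intro compact_Times) (auto simp: tame_def compact_closure)
  then have "bounded ((\<lambda>p. op (fst p) (snd p)) ` (closure (range f) \<times> closure (range g)))"
    by (intro compact_imp_bounded compact_continuous_image continuous_on_subset[OF assms(3)]) auto
  then show "bounded (range (\<lambda>x. op (f x) (g x)))"
  proof (rule bounded_subset, intro subsetI)
    fix y assume "y \<in> range (\<lambda>x. op (f x) (g x))"
    then obtain x where "y = op (f x) (g x)" by blast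
    moreover have "f x \<in> closure (range f)" "g x \<in> closure (range g)"
      by (auto intro: closure_subset[THEN subsetD])
    ultimately show "y \<in> (\<lambda>p. op (fst p) (snd p)) ` (closure (range f) \<times> closure (range g))"
      by (intro image_eqI[of _ _ "(f x, g x)"]) simp_all
  qed
  have "bounded ({x. f x \<noteq> 0} \<union> {x. g x \<noteq> 0})"
    using assms(1,2) by (simp add: tame_def)
  then show "bounded {x. op (f x) (g x) \<noteq> 0}"
  proof (rule bounded_subset, intro subsetI UnCI)
    fix x assume "x \<in> {x. op (f x) (g x) \<noteq> 0}" and "x \<notin> {x. g x \<noteq> 0}"
    then show "x \<in> {x. f x \<noteq> 0}" using assms(4) by (metis (mono_tags) mem_Collect_eq)
  qed
qed

lemma tame_compose:
  fixes h :: "'b::euclidean_space \<Rightarrow> 'c::euclidean_space"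
  assumes "tame f" "continuous_on UNIV h" "h 0 = 0"
  shows "tame (\<lambda>x. h (f x))"
  by (rule tame_combine[OF assms(1,1), of "\<lambda>a b. h a"])
    (auto intro!: continuous_intros continuous_on_compose2[OF assms(2)] assms(3))

lemma tame_diff: "tame f \<Longrightarrow> tame g \<Longrightarrow> tame (\<lambda>x. f x - g x)"
  and tame_inner: "tame f \<Longrightarrow> tame g \<Longrightarrow> tame (\<lambda>x. f x \<bullet> g x)"
  by (erule (1) tame_combine; auto intro!: continuous_intros)+

lemma tame_mult: "tame f \<Longrightarrow> tame g \<Longrightarrow> tame (\<lambda>x. f x * g x)" for f g :: "'a::euclidean_space \<Rightarrow> real"
  by (erule (1) tame_combine; auto intro!: continuous_intros)

lemma tame_scaleR: "tame f \<Longrightarrow> tame g \<Longrightarrow> tame (\<lambda>x. f x *\<^sub>R g x)"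
  by (erule (1) tame_combine; auto intro!: continuous_intros)

lemma tame_norm_sq: "tame f \<Longrightarrow> tame (\<lambda>x. (norm (f x))\<^sup>2)"
  by (erule tame_compose) (auto intro!: continuous_intros)

lemma tame_cmult: "tame f \<Longrightarrow> tame (\<lambda>x. c *\<^sub>R f x)"
  by (erule tame_compose) (auto intro!: continuous_intros)

lemma tame_continuous_on_open:
  fixes f :: "'a::euclidean_space \<Rightarrow> 'b::euclidean_space"
  assumes "open S" "bounded S" "continuous_on S f" "\<And>x. x \<in> S \<Longrightarrow> norm (f x) \<le> C"
    "\<And>x. x \<notin> S \<Longrightarrow> f x = 0"
  shows "tame f"
proof (rule tameI)
  have "(\<lambda>x. indicator S x *\<^sub>R f x) \<in> borel_measurable borel"
    using assms by (intro borel_measurable_continuous_on_indicator) auto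
  also have "(\<lambda>x. indicator S x *\<^sub>R f x) = f"
    using assms(5) by (auto simp: fun_eq_iff indicator_def)
  finally show "f \<in> borel_measurable borel" .
  show "norm (f x) \<le> max C 0" for x
    using assms(4,5) by (cases "x \<in> S") (simp_all add: le_max_iff_disj)
qed fact+

lemma tame_continuous:
  fixes f :: "'a::euclidean_space \<Rightarrow> 'b::euclidean_space"
  assumes "continuous_on UNIV f" "bounded S" "\<And>x. x \<notin> S \<Longrightarrow> f x = 0"
  shows "tame f"
proof -
  have "compact (closure S)" using assms(2) by (simp add: compact_closure)
  then have "bounded (f ` closure S)"
    by (intro compact_imp_bounded compact_continuous_image continuous_on_subset[OF assms(1)]) auto
  then obtain C where C: "\<And>x. x \<in> closure S \<Longrightarrow> norm (f x) \<le> C" unfolding bounded_iff by blast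
  show ?thesis
  proof (rule tameI)
    show "f \<in> borel_measurable borel" using assms(1) by (rule borel_measurable_continuous_onI)
    show "norm (f x) \<le> max C 0" for x
    proof (cases "x \<in> S")
      case True
      then have "x \<in> closure S" using closure_subset by blast
      then show ?thesis using C by (simp add: le_max_iff_disj)
    qed (simp add: assms(3))
  qed fact+
qed

lemma bounded_affine_vimage:
  fixes S :: "'a::euclidean_space set"
  assumes "bounded S" "t \<noteq> 0"
  shows "bounded {x. a + t *\<^sub>R (x - b) \<in> S}"
proof -
  have "bounded ((\<lambda>y. (b - inverse t *\<^sub>R a) + y) ` (\<lambda>y. inverse t *\<^sub>R y) ` S)"
    by (intro bounded_translation bounded_scaling assms(1))
  then show ?thesis
  proof (rule bounded_subset, intro subsetI)
    fix x assume "x \<in> {x. a + t *\<^sub>R (x - b) \<in> S}"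
    moreover have "x = (b - inverse t *\<^sub>R a) + inverse t *\<^sub>R (a + t *\<^sub>R (x - b))"
      using assms(2) by (simp add: scaleR_add_right)
    ultimately show "x \<in> (\<lambda>y. (b - inverse t *\<^sub>R a) + y) ` (\<lambda>y. inverse t *\<^sub>R y) ` S"
      by blast
  qed
qed

lemma tame_affine:
  assumes "tame f" "t \<noteq> 0"
  shows "tame (\<lambda>x. f (a + t *\<^sub>R (x - b)))"
proof -
  note [measurable] = tame_measurable[OF assms(1)]
  obtain C where C: "\<forall>x. norm (f x) \<le> C" using tame_bound[OF assms(1)] by blast
  have "bounded {x. f x \<noteq> 0}" using assms(1) by (simp add: tame_def)
  note supp = bounded_affine_vimage[OF this assms(2), of a b]
  show ?thesis
  proof (rule tameI)
    show "norm (f (a + t *\<^sub>R (x - b))) \<le> C" for x using C by blast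
    show "bounded {x. a + t *\<^sub>R (x - b) \<in> {x. f x \<noteq> 0}}" by (rule supp)
    show "(\<lambda>x. f (a + t *\<^sub>R (x - b))) \<in> borel_measurable borel" by measurable
  qed simp
qed

lemma tame_dominated_convergence:
  fixes s :: "nat \<Rightarrow> 'a::euclidean_space \<Rightarrow> 'b::euclidean_space"
  assumes meas: "\<And>n. s n \<in> borel_measurable borel" and bd: "\<And>n x. norm (s n x) \<le> C"
    and S: "bounded S" "\<And>n x. x \<notin> S \<Longrightarrow> s n x = 0"
    and lim: "\<And>x. (\<lambda>n. s n x) \<longlonglongrightarrow> f x"
  shows "(\<lambda>n. LINT x|lborel. s n x) \<longlonglongrightarrow> (LINT x|lborel. f x)"
proof -
  obtain R where "\<And>x. x \<in> S \<Longrightarrow> norm x \<le> R" using S(1) unfolding bounded_iff by blast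
  then have R: "S \<subseteq> cball 0 R" by auto
  show ?thesis
  proof (rule integral_dominated_convergence)
    show "f \<in> borel_measurable lborel"
      by (rule borel_measurable_LIMSEQ_metric[of s]) (use meas lim in simp_all)
    show "s n \<in> borel_measurable lborel" for n using meas by simp
    show "integrable lborel (\<lambda>x. indicator (cball 0 R) x *\<^sub>R C)"
      by (intro integrableI_bounded_set_indicator[where B="norm C"] emeasure_lborel_cball_finite) auto
    show "AE x in lborel. (\<lambda>n. s n x) \<longlonglongrightarrow> f x" using lim by simp
    show "AE x in lborel. norm (s n x) \<le> indicator (cball 0 R) x *\<^sub>R C" for n
    proof (rule AE_I2)
      fix x show "norm (s n x) \<le> indicator (cball 0 R) x *\<^sub>R C"
        using bd[of n x] S(2)[of x n] subsetD[OF R, of x] by (cases "x \<in> cball 0 R") auto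
    qed
  qed
qed

lemma lborel_integral_affine:
  fixes f :: "'a::euclidean_space \<Rightarrow> 'b::{banach,second_countable_topology}"
  assumes "f \<in> borel_measurable borel" "t > 0"
  shows "(LINT x|lborel. f (a + t *\<^sub>R (x - b))) = inverse t ^ DIM('a) *\<^sub>R (LINT x|lborel. f x)"
proof -
  have aff: "(LINT x|lborel. f x) = t ^ DIM('a) *\<^sub>R (LINT x|lborel. f ((a - t *\<^sub>R b) + t *\<^sub>R x))"
  proof -
    have "(LINT x|lborel. f x)
        = (LINT x|density (distr lborel borel (\<lambda>x. (a - t *\<^sub>R b) + t *\<^sub>R x)) (\<lambda>_. \<bar>t\<bar> ^ DIM('a)). f x)"
      using assms(2) by (subst lborel_affine[of t "a - t *\<^sub>R b"]) auto
    also have "\<dots> = (LINT x|distr lborel borel (\<lambda>x. (a - t *\<^sub>R b) + t *\<^sub>R x). \<bar>t\<bar> ^ DIM('a) *\<^sub>R f x)"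
      using assms by (subst integral_density) auto
    also have "\<dots> = (LINT x|lborel. \<bar>t\<bar> ^ DIM('a) *\<^sub>R f ((a - t *\<^sub>R b) + t *\<^sub>R x))"
      using assms by (subst integral_distr) auto
    finally show ?thesis using assms(2) by simp
  qed
  have shift: "(a - t *\<^sub>R b) + t *\<^sub>R x = a + t *\<^sub>R (x - b)" for x
    by (simp add: algebra_simps)
  show ?thesis unfolding aff shift using assms(2)
    by (simp only: scaleR_scaleR power_mult_distrib[symmetric]) simp
qed

lemma lborel_integral_translate:
  fixes f :: "'a::euclidean_space \<Rightarrow> 'b::{banach,second_countable_topology}"
  assumes "f \<in> borel_measurable borel"
  shows "(LINT x|lborel. f (x + a)) = (LINT x|lborel. f x)"
  using lborel_integral_affine[OF assms, of 1 a 0] by (simp add: add.commute)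

lemma lborel_integral_reflect:
  fixes f :: "'a::euclidean_space \<Rightarrow> 'b::{banach,second_countable_topology}"
  assumes [measurable]: "f \<in> borel_measurable borel"
  shows "(LINT x|lborel. f (a - x)) = (LINT x|lborel. f x)"
proof -
  have "(LINT x|lborel. f x)
      = (LINT x|density (distr lborel borel (\<lambda>x. a + (- 1) *\<^sub>R x)) (\<lambda>_. \<bar>- 1::real\<bar> ^ DIM('a)). f x)"
    by (subst lborel_affine[of "- 1" a]) auto
  also have "\<dots> = (LINT x|distr lborel borel (\<lambda>x. a + (- 1) *\<^sub>R x). f x)"
    by (subst integral_density) auto
  also have "\<dots> = (LINT x|lborel. f (a - x))"
    by (subst integral_distr) auto
  finally show ?thesis by simp
qed

lemma set_lebesgue_integral_eq_lborel:
  fixes f g :: "'a::euclidean_space \<Rightarrow> 'b::{banach,second_countable_topology}"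
  assumes "g \<in> borel_measurable borel" "\<And>x. x \<in> S \<Longrightarrow> f x = g x" "\<And>x. x \<notin> S \<Longrightarrow> g x = 0"
  shows "(LINT x:S|lebesgue. f x) = (LINT x|lborel. g x)"
proof -
  have "(\<lambda>x. indicator S x *\<^sub>R f x) = g"
    using assms(2,3) by (auto simp: fun_eq_iff indicator_def)
  then show ?thesis
    using assms(1) by (simp add: set_lebesgue_integral_def integral_completion)
qed

section \<open>Continuously differentiable functions with compact support lie in the Sobolev space\<close>

lemma GDERIV_unique:
  assumes "GDERIV f x :> D" "GDERIV f x :> D'" shows "D = D'"
proof -
  have "(\<lambda>h. h \<bullet> D) = (\<lambda>h. h \<bullet> D')"
    using assms has_derivative_unique unfolding gderiv_def by blast
  then have "(D - D') \<bullet> (D - D') = 0" by (metis inner_diff_right right_minus_eq)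
  then show ?thesis by simp
qed

lemma grad_eq: "GDERIV f x :> D \<Longrightarrow> grad f x = D"
  unfolding grad_def by (rule the_equality) (auto intro: GDERIV_unique)

lemma GDERIV_transform_open:
  assumes "GDERIV f x :> D" "open S" "x \<in> S" "\<And>y. y \<in> S \<Longrightarrow> f y = g y"
  shows "GDERIV g x :> D"
  using assms unfolding gderiv_def by (rule has_derivative_transform_within_open)

lemma GDERIV_eq_0_of_locally_0:
  assumes "open S" "x \<in> S" "\<And>y. y \<in> S \<Longrightarrow> f y = 0"
  shows "GDERIV f x :> 0"
  by (rule GDERIV_transform_open[OF GDERIV_const assms(1,2)]) (simp add: assms(3))

lemma GDERIV_continuous: "GDERIV f x :> D \<Longrightarrow> isCont f x"
  unfolding gderiv_def by (rule has_derivative_continuous)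

lemma smooth_gradient:
  fixes f :: "'a::euclidean_space \<Rightarrow> real"
  assumes "smooth_on UNIV f"
  shows "GDERIV f x :> grad f x" and "continuous_on UNIV (grad f)"
proof -
  define D where "D x = (\<Sum>i\<in>Basis. frechet_derivative f (at x) i *\<^sub>R i)" for x :: 'a
  have D: "GDERIV f x :> D x" for x
  proof -
    note d = smooth_on_UNIV_derivative(1)[OF assms, of x]
    interpret bounded_linear "frechet_derivative f (at x)"
      using d by (rule has_derivative_bounded_linear)
    have "frechet_derivative f (at x) h = h \<bullet> D x" for h
    proof -
      have "frechet_derivative f (at x) h = frechet_derivative f (at x) (\<Sum>i\<in>Basis. (h \<bullet> i) *\<^sub>R i)"
        by (simp add: euclidean_representation)
      also have "\<dots> = h \<bullet> D x"
        by (simp add: sum scaleR D_def inner_sum_right mult.commute)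
      finally show ?thesis .
    qed
    then have "frechet_derivative f (at x) = (\<lambda>h. h \<bullet> D x)" by (rule ext)
    with d show ?thesis by (simp add: gderiv_def)
  qed
  then have "grad f = D" by (intro ext grad_eq)
  then show "GDERIV f x :> grad f x" using D by simp
  have "continuous_on UNIV D"
    unfolding D_def
    by (intro continuous_intros smooth_on_UNIV_derivative(3)[OF smooth_on_UNIV_derivative(2)[OF assms]])
  with \<open>grad f = D\<close> show "continuous_on UNIV (grad f)" by simp
qed

lemma GDERIV_lipschitz:
  assumes "convex S" "\<And>x. x \<in> S \<Longrightarrow> GDERIV f x :> G x" "\<And>x. x \<in> S \<Longrightarrow> norm (G x) \<le> L"
    "x \<in> S" "y \<in> S"
  shows "\<bar>f x - f y\<bar> \<le> L * norm (x - y)"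
proof -
  have "norm (f x - f y) \<le> L * norm (x - y)"
  proof (rule differentiable_bound[OF assms(1) _ _ assms(4,5)])
    fix z assume z: "z \<in> S"
    show "(f has_derivative (\<lambda>h. h \<bullet> G z)) (at z within S)"
      using assms(2)[OF z] unfolding gderiv_def by (rule has_derivative_at_withinI)
    show "onorm (\<lambda>h. h \<bullet> G z) \<le> L"
    proof (rule onorm_bound)
      show "0 \<le> L" using assms(3)[OF z] norm_ge_zero order_trans by blast
      show "norm (h \<bullet> G z) \<le> L * norm h" for h
        using Cauchy_Schwarz_ineq2[of h "G z"] mult_right_mono[OF assms(3)[OF z], of "norm h"]
        by (simp add: mult.commute)
    qed
  qed
  then show ?thesis by simp
qed

lemma gradient_eq_0_off_support:
  fixes w :: "'a::euclidean_space \<Rightarrow> real"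
  assumes "\<And>x. GDERIV w x :> G x" "closed K" "\<And>x. x \<notin> K \<Longrightarrow> w x = 0" "x \<notin> K"
  shows "G x = 0"
  by (rule GDERIV_unique[OF assms(1) GDERIV_eq_0_of_locally_0[of "- K"]])
    (use assms in auto)

text \<open>The integral of every difference quotient \<open>(w (x + h v) - w x) / h\<close> vanishes by translation invariance,
and the quotients converge boundedly to \<open>G x \<bullet> v\<close>. Applied to products, this is the integration by
parts used throughout.\<close>

lemma integral_gradient_eq_0:
  fixes w :: "'a::euclidean_space \<Rightarrow> real"
  assumes der: "\<And>x. GDERIV w x :> G x" and cont: "continuous_on UNIV G"
    and K: "compact K" "\<And>x. x \<notin> K \<Longrightarrow> w x = 0"
  shows "(LINT x|lborel. G x) = 0"
proof -
  have K': "closed K" "bounded K"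
    using K(1) compact_imp_closed compact_imp_bounded by blast+
  have G0: "G x = 0" if "x \<notin> K" for x
    by (rule gradient_eq_0_off_support[OF der K'(1) K(2) that])
  have tG: "tame G" by (rule tame_continuous[OF cont K'(2) G0])
  obtain L where L: "\<forall>x. norm (G x) \<le> L" using tame_bound[OF tG] by blast
  have lip: "\<bar>w x - w y\<bar> \<le> L * norm (x - y)" for x y
    by (rule GDERIV_lipschitz[of UNIV]) (use der L in auto)
  have contw: "continuous_on UNIV w"
    using GDERIV_continuous[OF der] by (intro continuous_at_imp_continuous_on) blast
  have tw: "tame w" by (rule tame_continuous[OF contw K'(2) K(2)])
  have "(LINT x|lborel. G x) \<bullet> v = 0" for v
  proof -
    define h where "h n = inverse (real (Suc n))" for n
    have h: "h n > 0" "h n \<le> 1" for n by (simp_all add: h_def inverse_le_1_iff)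
    have h0: "h \<longlonglongrightarrow> 0" unfolding h_def by (rule LIMSEQ_inverse_real_of_nat)
    define s where "s n x = (w (x + h n *\<^sub>R v) - w x) / h n" for n x
    have "(\<lambda>n. LINT x|lborel. s n x) \<longlonglongrightarrow> (LINT x|lborel. G x \<bullet> v)"
    proof (rule tame_dominated_convergence)
      have [measurable]: "w \<in> borel_measurable borel" by (rule tame_measurable[OF tw])
      show "s n \<in> borel_measurable borel" for n unfolding s_def by measurable
      show "norm (s n x) \<le> L * norm v" for n x
        using lip[of "x + h n *\<^sub>R v" x] h(1)[of n]
        by (simp add: s_def field_simps)
      have "bounded {x - y |x y. x \<in> K \<and> y \<in> cball 0 (norm v)}"
        by (intro compact_imp_bounded compact_differences K(1) compact_cball)
      then show "bounded (K \<union> {x - y |x y. x \<in> K \<and> y \<in> cball 0 (norm v)})"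
        using K'(2) by simp
      show "s n x = 0" if "x \<notin> K \<union> {x - y |x y. x \<in> K \<and> y \<in> cball 0 (norm v)}" for n x
      proof -
        have "x + h n *\<^sub>R v \<notin> K"
        proof
          assume "x + h n *\<^sub>R v \<in> K"
          moreover have "h n *\<^sub>R v \<in> cball 0 (norm v)"
            using h[of n] mult_right_mono[of "h n" 1 "norm v"] by simp
          moreover have "x = (x + h n *\<^sub>R v) - h n *\<^sub>R v" by simp
          ultimately show False using that by blast
        qed
        with that show ?thesis by (simp add: s_def K(2))
      qed
      show "(\<lambda>n. s n x) \<longlonglongrightarrow> G x \<bullet> v" for x
      proof -
        have "((\<lambda>t. x + t *\<^sub>R v) has_derivative (\<lambda>t. t *\<^sub>R v)) (at 0)"
          by (auto intro!: derivative_eq_intros)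
        then have "((\<lambda>t. w (x + t *\<^sub>R v)) has_derivative (\<lambda>t. (t *\<^sub>R v) \<bullet> G x)) (at 0)"
          by (rule has_derivative_compose) (use der[of x] in \<open>simp add: gderiv_def\<close>)
        then have "((\<lambda>t. w (x + t *\<^sub>R v)) has_real_derivative (G x \<bullet> v)) (at 0)"
          by (simp add: has_field_derivative_def inner_commute mult_commute_abs)
        then have "((\<lambda>t. (w (x + t *\<^sub>R v) - w x) / t) \<longlongrightarrow> G x \<bullet> v) (at 0)"
          by (simp add: has_field_derivative_iff)
        from filterlim_compose[OF this, of h sequentially] h0 h(1)
        show ?thesis unfolding s_def by (simp add: filterlim_at less_imp_neq[symmetric])
      qed
    qed
    moreover have "(LINT x|lborel. s n x) = 0" for n
    proof -
      have "(LINT x|lborel. w (x + h n *\<^sub>R v) - w x)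
          = (LINT x|lborel. w (x + h n *\<^sub>R v)) - (LINT x|lborel. w x)"
        using tame_affine[OF tw, of 1 "h n *\<^sub>R v" 0]
        by (intro Bochner_Integration.integral_diff tame_integrable tw) (simp add: add.commute)
      also have "\<dots> = 0"
        using lborel_integral_translate[OF tame_measurable[OF tw]] by simp
      finally show ?thesis unfolding s_def by simp
    qed
    ultimately have "(\<lambda>n::nat. 0) \<longlonglongrightarrow> (LINT x|lborel. G x \<bullet> v)" by simp
    then have "(LINT x|lborel. G x \<bullet> v) = 0" by (simp add: LIMSEQ_const_iff)
    then show ?thesis using tame_integrable[OF tG] by simp
  qed
  from this[of "LINT x|lborel. G x"] show ?thesis by simp
qed

text \<open>A mollification averages \<open>h\<close> with total weight one over the ball of radius \<open>d\<close>, so it differs from \<open>h x\<close>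
by at most the oscillation of \<open>h\<close> over that ball.\<close>

lemma mollification_close:
  fixes h :: "'a::euclidean_space \<Rightarrow> 'b::euclidean_space"
  assumes \<kappa>: "continuous_on UNIV \<kappa>" "\<And>z. \<kappa> z \<ge> 0" "\<And>z. norm z \<ge> d \<Longrightarrow> \<kappa> z = 0"
      "(LINT z|lborel. \<kappa> z) = 1"
    and h: "tame h" and close: "\<And>y. norm (x - y) < d \<Longrightarrow> norm (h y - h x) \<le> e"
  shows "norm ((LINT y|lborel. \<kappa> (x - y) *\<^sub>R h y) - h x) \<le> e"
proof -
  have t\<kappa>: "tame \<kappa>"
    by (rule tame_continuous[OF \<kappa>(1), of "cball 0 d"]) (use \<kappa>(3) in auto)
  have t\<kappa>x: "tame (\<lambda>y. \<kappa> (x - y))"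
    using tame_affine[OF t\<kappa>, of "- 1" x 0] by simp
  have one: "(LINT y|lborel. \<kappa> (x - y)) = 1"
    using lborel_integral_reflect[OF tame_measurable[OF t\<kappa>]] \<kappa>(4) by simp
  have i1: "integrable lborel (\<lambda>y. \<kappa> (x - y) *\<^sub>R h y)"
    by (intro tame_integrable tame_scaleR t\<kappa>x h)
  have i2: "integrable lborel (\<lambda>y. \<kappa> (x - y) *\<^sub>R h x)"
    by (rule integrable_scaleR_left) (rule tame_integrable[OF t\<kappa>x])
  have "(LINT y|lborel. \<kappa> (x - y) *\<^sub>R h x) = h x"
    using one tame_integrable[OF t\<kappa>x] by simp
  then have "(LINT y|lborel. \<kappa> (x - y) *\<^sub>R h y) - h x
      = (LINT y|lborel. \<kappa> (x - y) *\<^sub>R h y - \<kappa> (x - y) *\<^sub>R h x)"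
    using i1 i2 by simp
  also have "norm \<dots> \<le> (LINT y|lborel. norm (\<kappa> (x - y) *\<^sub>R h y - \<kappa> (x - y) *\<^sub>R h x))"
    by (rule integral_norm_bound)
  also have "\<dots> \<le> (LINT y|lborel. \<kappa> (x - y) * e)"
  proof (rule integral_mono)
    show "integrable lborel (\<lambda>y. norm (\<kappa> (x - y) *\<^sub>R h y - \<kappa> (x - y) *\<^sub>R h x))"
      using i1 i2 by (intro integrable_norm Bochner_Integration.integrable_diff)
    show "integrable lborel (\<lambda>y. \<kappa> (x - y) * e)"
      using tame_integrable[OF t\<kappa>x] by simp
    fix y
    have "norm (\<kappa> (x - y) *\<^sub>R h y - \<kappa> (x - y) *\<^sub>R h x) = \<kappa> (x - y) * norm (h y - h x)"
      using \<kappa>(2)[of "x - y"] by (simp flip: scaleR_diff_right)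
    also have "\<dots> \<le> \<kappa> (x - y) * e"
      using \<kappa>(2)[of "x - y"] \<kappa>(3)[of "x - y"] close[of y]
      by (cases "norm (x - y) < d") (auto intro: mult_left_mono)
    finally show "norm (\<kappa> (x - y) *\<^sub>R h y - \<kappa> (x - y) *\<^sub>R h x) \<le> \<kappa> (x - y) * e" .
  qed
  also have "\<dots> = e" using one by simp
  finally show ?thesis .
qed

text \<open>The approximation is a mollification \<open>\<psi>\<close> of \<open>\<phi>\<close>. Integration by parts moves the derivative from the kernel
to \<open>\<phi>\<close>, so \<open>grad \<psi>\<close> is the mollification of \<open>G\<close>, and both errors are controlled by uniform continuity.\<close>

lemma smooth_approximation_C1:
  fixes \<phi> :: "'a::euclidean_space \<Rightarrow> real"
  assumes "open \<Omega>" and K: "compact K" "K \<subseteq> \<Omega>" "\<And>x. x \<notin> K \<Longrightarrow> \<phi> x = 0"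
    and der: "\<And>x. GDERIV \<phi> x :> G x" and contG: "continuous_on UNIV G" and "e > 0"
  shows "\<exists>\<psi>. test_function \<Omega> \<psi> \<and> (\<forall>x. \<bar>\<psi> x - \<phi> x\<bar> \<le> e \<and> norm (grad \<psi> x - G x) \<le> e)"
proof -
  have K': "closed K" "bounded K"
    using K(1) compact_imp_closed compact_imp_bounded by blast+
  have G0: "G x = 0" if "x \<notin> K" for x
    by (rule gradient_eq_0_off_support[OF der K'(1) K(3) that])
  have cont: "continuous_on UNIV \<phi>"
    using GDERIV_continuous[OF der] by (intro continuous_at_imp_continuous_on) blast
  have t\<phi>: "tame \<phi>" by (rule tame_continuous[OF cont K'(2) K(3)])
  have tG: "tame G" by (rule tame_continuous[OF contG K'(2) G0])
  \<comment> \<open>\<open>d1\<close> keeps the support inside \<open>\<Omega>\<close>; \<open>d2\<close> and \<open>d3\<close> bound the oscillation of \<open>\<phi>\<close> and of \<open>G\<close>.\<close>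
  obtain d1 where d1: "d1 > 0" "(\<Union>x\<in>K. cball x d1) \<subseteq> \<Omega>"
    using compact_subset_open_imp_cball_epsilon_subset[OF K(1) assms(1) K(2)] by blast
  have unif: "\<exists>d>0. \<forall>x y. norm (x - y) < d \<longrightarrow> norm (h y - h x) \<le> e"
    if h: "continuous_on UNIV h" "\<And>x. x \<notin> K \<Longrightarrow> h x = 0" for h :: "'a \<Rightarrow> 'b::euclidean_space"
  proof -
    \<comment> \<open>\<open>h\<close> is uniformly continuous on a compact neighbourhood of its support and vanishes elsewhere.\<close>
    define B where "B = {x + y |x y. x \<in> K \<and> y \<in> cball 0 (1::real)}"
    have "compact B" unfolding B_def by (rule compact_sums[OF K(1) compact_cball])
    then have "uniformly_continuous_on B h"
      using continuous_on_subset[OF h(1)] by (intro compact_uniformly_continuous) simp_all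
    then obtain d where d: "d > 0"
      "\<And>x y. x \<in> B \<Longrightarrow> y \<in> B \<Longrightarrow> dist y x < d \<Longrightarrow> dist (h y) (h x) < e"
      unfolding uniformly_continuous_on_def using \<open>e > 0\<close> by metis
    have inB: "z \<in> B" if "k \<in> K" "norm (z - k) \<le> 1" for z k
      unfolding B_def using that by (intro CollectI exI[of _ k] exI[of _ "z - k"]) auto
    have "norm (h y - h x) \<le> e" if "norm (x - y) < min d 1" for x y
    proof (cases "x \<in> K \<or> y \<in> K")
      case True
      then have "x \<in> B" "y \<in> B"
        using inB[of x x] inB[of y y] inB[of x y] inB[of y x] that
        by (auto simp: norm_minus_commute)
      from d(2)[OF this] that show ?thesis
        by (simp add: dist_norm norm_minus_commute)
    next
      case False then show ?thesis using h(2) \<open>e > 0\<close> by simp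
    qed
    with d(1) show ?thesis by (intro exI[of _ "min d 1"]) auto
  qed
  obtain d2 where d2: "d2 > 0" "\<And>x y. norm (x - y) < d2 \<Longrightarrow> norm (\<phi> y - \<phi> x) \<le> e"
    using unif[OF cont K(3)] by blast
  obtain d3 where d3: "d3 > 0" "\<And>x y. norm (x - y) < d3 \<Longrightarrow> norm (G y - G x) \<le> e"
    using unif[OF contG G0] by blast
  define d where "d = min d1 (min d2 d3)"
  have d: "d > 0" "d \<le> d1" "d \<le> d2" "d \<le> d3" using d1 d2 d3 by (auto simp: d_def)
  obtain \<kappa> :: "'a \<Rightarrow> real" where \<kappa>: "smooth_on UNIV \<kappa>" "\<And>x. \<kappa> x \<ge> 0"
    "\<And>x. norm x \<ge> d \<Longrightarrow> \<kappa> x = 0" "integrable lborel \<kappa>" "(LINT x|lborel. \<kappa> x) = 1"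
    using smooth_bump_exists[OF d(1)] by metis
  note cont\<kappa> = smooth_on_UNIV_derivative(3)[OF \<kappa>(1)]
  note g\<kappa> = smooth_gradient[OF \<kappa>(1)]
  obtain a where a: "K \<subseteq> cbox (- a) a" using bounded_subset_cbox_symmetric[OF K'(2)] by blast
  define \<psi> where "\<psi> x = integral (cbox (- a) a) (\<lambda>y. \<phi> y * \<kappa> (x - y))" for x
  have to_lborel: "integral (cbox (- a) a) f = (LINT y|lborel. f y)"
    if "tame f" "\<And>y. y \<notin> K \<Longrightarrow> f y = 0" for f :: "'a \<Rightarrow> real"
  proof -
    have "(\<lambda>y. if y \<in> cbox (- a) a then f y else 0) = f"
      using that(2) a by (auto simp: fun_eq_iff)
    then have "integral (cbox (- a) a) f = integral UNIV f"
      using integral_restrict_UNIV[of "cbox (- a) a" f] by simp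
    also have "\<dots> = (LINT y|lborel. f y)" by (rule integral_lborel[OF tame_integrable[OF that(1)]])
    finally show ?thesis .
  qed
  have t\<kappa>: "tame (\<lambda>y. \<kappa> (x - y))" for x
    by (rule tame_continuous[of _ "cball x d"])
      (auto intro!: continuous_on_compose2[OF cont\<kappa>] continuous_intros \<kappa>(3) simp: dist_norm)
  have \<psi>: "\<psi> x = (LINT y|lborel. \<kappa> (x - y) *\<^sub>R \<phi> y)" for x
    unfolding \<psi>_def by (subst to_lborel) (auto intro: tame_mult[OF t\<phi> t\<kappa>] simp: K(3) mult.commute)
  have smooth\<psi>: "smooth_on UNIV \<psi>"
    unfolding \<psi>_def by (rule smooth_on_convolution[OF cont \<kappa>(1)])
  have grad\<psi>: "GDERIV \<psi> x :> (LINT y|lborel. \<kappa> (x - y) *\<^sub>R G y)" for x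
  proof -
    have tg: "tame (\<lambda>y. \<phi> y *\<^sub>R grad \<kappa> (x - y))"
      by (rule tame_continuous[OF _ K'(2)])
        (auto intro!: continuous_intros continuous_on_compose2[OF g\<kappa>(2)] continuous_on_subset[OF cont] simp: K(3))
    have tkG: "tame (\<lambda>y. \<kappa> (x - y) *\<^sub>R G y)" by (rule tame_scaleR[OF t\<kappa> tG])
    have "(LINT y|lborel. \<kappa> (x - y) *\<^sub>R G y - \<phi> y *\<^sub>R grad \<kappa> (x - y)) = 0"
    proof (rule integral_gradient_eq_0[OF _ _ K(1)])
      fix y
      have "((\<lambda>y. \<kappa> (x - y)) has_derivative (\<lambda>h. (- h) \<bullet> grad \<kappa> (x - y))) (at y)"
        by (rule has_derivative_compose[of "\<lambda>y. x - y" "\<lambda>h. - h"])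
          (use g\<kappa>(1)[of "x - y"] in \<open>auto intro!: derivative_eq_intros simp: gderiv_def\<close>)
      then have "GDERIV (\<lambda>y. \<kappa> (x - y)) y :> - grad \<kappa> (x - y)" by (simp add: gderiv_def)
      from GDERIV_mult[OF der[of y] this]
      show "GDERIV (\<lambda>y. \<phi> y * \<kappa> (x - y)) y :> \<kappa> (x - y) *\<^sub>R G y - \<phi> y *\<^sub>R grad \<kappa> (x - y)"
        by (simp add: add.commute)
      show "continuous_on UNIV (\<lambda>y. \<kappa> (x - y) *\<^sub>R G y - \<phi> y *\<^sub>R grad \<kappa> (x - y))"
        by (intro continuous_intros continuous_on_compose2[OF g\<kappa>(2)] continuous_on_compose2[OF cont\<kappa>]
            contG cont) auto
      show "\<phi> y * \<kappa> (x - y) = 0" if "y \<notin> K" using K(3)[OF that] by simp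
    qed
    then have eq: "(LINT y|lborel. \<phi> y *\<^sub>R grad \<kappa> (x - y)) = (LINT y|lborel. \<kappa> (x - y) *\<^sub>R G y)"
      using tame_integrable[OF tg] tame_integrable[OF tkG] by simp
    have "(\<psi> has_derivative
        (\<lambda>v. integral (cbox (- a) a) (\<lambda>y. \<phi> y * (v \<bullet> grad \<kappa> (x - y))))) (at x)"
      unfolding \<psi>_def
      by (rule has_derivative_convolution[OF cont])
        (use g\<kappa> in \<open>auto simp: gderiv_def intro!: continuous_intros\<close>)
    moreover have "integral (cbox (- a) a) (\<lambda>y. \<phi> y * (v \<bullet> grad \<kappa> (x - y)))
        = v \<bullet> (LINT y|lborel. \<phi> y *\<^sub>R grad \<kappa> (x - y))" for v
    proof -
      have "tame (\<lambda>y. \<phi> y * (v \<bullet> grad \<kappa> (x - y)))"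
        by (rule tame_continuous[OF _ K'(2)])
          (auto intro!: continuous_intros continuous_on_compose2[OF g\<kappa>(2)] continuous_on_subset[OF cont] simp: K(3))
      then have "integral (cbox (- a) a) (\<lambda>y. \<phi> y * (v \<bullet> grad \<kappa> (x - y)))
          = (LINT y|lborel. v \<bullet> (\<phi> y *\<^sub>R grad \<kappa> (x - y)))"
        by (subst to_lborel) (auto simp: K(3))
      also have "\<dots> = v \<bullet> (LINT y|lborel. \<phi> y *\<^sub>R grad \<kappa> (x - y))"
        by (rule integral_inner_right) (use tame_integrable[OF tg] in simp)
      finally show ?thesis .
    qed
    ultimately show ?thesis unfolding gderiv_def eq by simp
  qed
  have supp: "closure {x. \<psi> x \<noteq> 0} \<subseteq> {x + y |x y. x \<in> K \<and> y \<in> cball 0 d}" (is "_ \<subseteq> ?S")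
  proof (rule closure_minimal)
    have cS: "compact ?S" by (rule compact_sums[OF K(1) compact_cball])
    then show "closed ?S" by (rule compact_imp_closed)
    show "{x. \<psi> x \<noteq> 0} \<subseteq> ?S"
    proof (intro subsetI, rule ccontr)
      fix x assume "x \<in> {x. \<psi> x \<noteq> 0}" and x: "x \<notin> ?S"
      have "\<kappa> (x - y) *\<^sub>R \<phi> y = 0" for y
      proof (cases "y \<in> K")
        case True
        have "norm (x - y) > d"
        proof (rule ccontr)
          assume "\<not> norm (x - y) > d"
          then have "x - y \<in> cball 0 d" by simp
          moreover have "x = y + (x - y)" by simp
          ultimately show False using x True by blast
        qed
        then show ?thesis using \<kappa>(3)[of "x - y"] by simp
      qed (simp add: K(3))
      then have "\<psi> x = (LINT y::'a|lborel. 0)" unfolding \<psi> by (simp only:)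
      with \<open>x \<in> {x. \<psi> x \<noteq> 0}\<close> show False by simp
    qed
  qed
  have "?S \<subseteq> \<Omega>"
  proof
    fix z assume "z \<in> ?S"
    then obtain x y where "z = x + y" "x \<in> K" "norm y \<le> d" by auto
    then have "z \<in> cball x d1" using d(2) by (simp add: dist_norm)
    with d1(2) \<open>x \<in> K\<close> show "z \<in> \<Omega>" by blast
  qed
  have "test_function \<Omega> \<psi>"
    unfolding test_function_def
  proof (intro conjI smooth\<psi>)
    have "compact ?S" by (rule compact_sums[OF K(1) compact_cball])
    then have "bounded (closure {x. \<psi> x \<noteq> 0})"
      using supp compact_imp_bounded bounded_subset by blast
    then show "compact (closure {x. \<psi> x \<noteq> 0})" by (simp add: compact_eq_bounded_closed)
    show "closure {x. \<psi> x \<noteq> 0} \<subseteq> \<Omega>" using supp \<open>?S \<subseteq> \<Omega>\<close> by blast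
  qed
  moreover have "\<bar>\<psi> x - \<phi> x\<bar> \<le> e" for x
  proof -
    have "norm ((LINT y|lborel. \<kappa> (x - y) *\<^sub>R \<phi> y) - \<phi> x) \<le> e"
      by (rule mollification_close[OF cont\<kappa> \<kappa>(2,3,5) t\<phi>]) (use d(3) d2(2) in auto)
    then show ?thesis by (simp add: \<psi>)
  qed
  moreover have "norm (grad \<psi> x - G x) \<le> e" for x
    unfolding grad_eq[OF grad\<psi>]
    by (rule mollification_close[OF cont\<kappa> \<kappa>(2,3,5) tG]) (use d(4) d3(2) in auto)
  ultimately show ?thesis by blast
qed

lemma in_L2_tame:
  assumes "tame f" "open \<Omega>" "\<And>x. x \<notin> \<Omega> \<Longrightarrow> f x = 0"
  shows "in_L2 \<Omega> f"
proof -
  have eq: "(\<lambda>x. indicator \<Omega> x *\<^sub>R f x) = f"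
    "(\<lambda>x. indicator \<Omega> x *\<^sub>R (norm (f x))\<^sup>2) = (\<lambda>x. (norm (f x))\<^sup>2)"
    using assms(3) by (auto simp: fun_eq_iff indicator_def)
  have t: "tame (\<lambda>x. (norm (f x))\<^sup>2)" by (rule tame_norm_sq[OF assms(1)])
  have "f \<in> borel_measurable lebesgue"
    by (rule measurable_completion) (simp add: tame_measurable[OF assms(1)])
  moreover have "integrable lebesgue (\<lambda>x. (norm (f x))\<^sup>2)"
    using tame_integrable[OF t] tame_measurable[OF t] by (subst integrable_completion) simp_all
  ultimately show ?thesis
    unfolding in_L2_def set_borel_measurable_def set_integrable_def eq by simp
qed

text \<open>This is the only entry to the test functions of a weak solution: everything else is reached from here
by limits in the integral identity.\<close>

lemma C1_compact_support_in_H10: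
  fixes \<phi> :: "'a::euclidean_space \<Rightarrow> real"
  assumes \<Omega>: "open \<Omega>" "bounded \<Omega>" and K: "compact K" "K \<subseteq> \<Omega>" "\<And>x. x \<notin> K \<Longrightarrow> \<phi> x = 0"
    and der: "\<And>x. GDERIV \<phi> x :> G x" and contG: "continuous_on UNIV G"
  shows "in_H10 \<Omega> \<phi> G"
proof -
  have K': "closed K" "bounded K"
    using K(1) compact_imp_closed compact_imp_bounded by blast+
  have G0: "G x = 0" if "x \<notin> K" for x
    by (rule gradient_eq_0_off_support[OF der K'(1) K(3) that])
  have cont: "continuous_on UNIV \<phi>"
    using GDERIV_continuous[OF der] by (intro continuous_at_imp_continuous_on) blast
  have t\<phi>: "tame \<phi>" by (rule tame_continuous[OF cont K'(2) K(3)])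
  have tG: "tame G" by (rule tame_continuous[OF contG K'(2) G0])
  have off: "\<phi> x = 0" "G x = 0" if "x \<notin> \<Omega>" for x using that K G0 by auto
  have "weak_gradient \<Omega> \<phi> G"
    unfolding weak_gradient_def
  proof (intro allI impI)
    fix \<psi> assume "test_function \<Omega> \<psi>"
    then have sm: "smooth_on UNIV \<psi>" by (simp add: test_function_def)
    note g = smooth_gradient[OF sm]
    note c\<psi> = smooth_on_UNIV_derivative(3)[OF sm]
    have t1: "tame (\<lambda>x. \<phi> x *\<^sub>R grad \<psi> x)"
      by (rule tame_continuous[OF _ K'(2)]) (auto intro!: continuous_intros cont g simp: K(3))
    have t2: "tame (\<lambda>x. \<psi> x *\<^sub>R G x)"
      by (rule tame_continuous[OF _ K'(2)]) (auto intro!: continuous_intros contG c\<psi> simp: G0)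
    have "(LINT x|lborel. \<phi> x *\<^sub>R grad \<psi> x + \<psi> x *\<^sub>R G x) = 0"
    proof (rule integral_gradient_eq_0[OF _ _ K(1)])
      show "GDERIV (\<lambda>x. \<phi> x * \<psi> x) x :> \<phi> x *\<^sub>R grad \<psi> x + \<psi> x *\<^sub>R G x" for x
        by (rule GDERIV_mult[OF der g(1)])
      show "continuous_on UNIV (\<lambda>x. \<phi> x *\<^sub>R grad \<psi> x + \<psi> x *\<^sub>R G x)"
        by (intro continuous_intros cont contG c\<psi> g(2))
      show "\<phi> x * \<psi> x = 0" if "x \<notin> K" for x using K(3)[OF that] by simp
    qed
    then have "(LINT x|lborel. \<phi> x *\<^sub>R grad \<psi> x) + (LINT x|lborel. \<psi> x *\<^sub>R G x) = 0"
      using tame_integrable[OF t1] tame_integrable[OF t2] by simp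
    moreover have "(LINT x:\<Omega>|lebesgue. \<phi> x *\<^sub>R grad \<psi> x) = (LINT x|lborel. \<phi> x *\<^sub>R grad \<psi> x)"
      by (rule set_lebesgue_integral_eq_lborel[OF tame_measurable[OF t1]]) (simp_all add: off)
    moreover have "(LINT x:\<Omega>|lebesgue. \<psi> x *\<^sub>R G x) = (LINT x|lborel. \<psi> x *\<^sub>R G x)"
      by (rule set_lebesgue_integral_eq_lborel[OF tame_measurable[OF t2]]) (simp_all add: off)
    ultimately show "(LINT x:\<Omega>|lebesgue. \<phi> x *\<^sub>R grad \<psi> x) = - (LINT x:\<Omega>|lebesgue. \<psi> x *\<^sub>R G x)"
      by (simp add: eq_neg_iff_add_eq_0)
  qed
  moreover have "\<forall>k::nat. \<exists>\<psi>. test_function \<Omega> \<psi> \<and> (\<forall>x. \<bar>\<psi> x - \<phi> x\<bar> \<le> inverse (real (Suc k))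
      \<and> norm (grad \<psi> x - G x) \<le> inverse (real (Suc k)))"
  proof
    fix k :: nat
    have "inverse (real (Suc k)) > 0" by simp
    then show "\<exists>\<psi>. test_function \<Omega> \<psi> \<and> (\<forall>x. \<bar>\<psi> x - \<phi> x\<bar> \<le> inverse (real (Suc k))
      \<and> norm (grad \<psi> x - G x) \<le> inverse (real (Suc k)))"
      using K(3) by (intro smooth_approximation_C1[OF \<Omega>(1) K(1,2) _ der contG])
  qed
  then obtain \<psi> where \<psi>: "\<And>k. test_function \<Omega> (\<psi> k)"
    "\<And>k x. \<bar>\<psi> k x - \<phi> x\<bar> \<le> inverse (real (Suc k))"
    "\<And>k x. norm (grad (\<psi> k) x - G x) \<le> inverse (real (Suc k))"
    by metis
  have lim: "(\<lambda>k. (LINT x:\<Omega>|lebesgue. (norm (h k x - l x))\<^sup>2)) \<longlonglongrightarrow> 0"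
    if h: "\<And>k. continuous_on UNIV (h k)" and l: "continuous_on UNIV l"
      and b: "\<And>k x. norm (h k x - l x) \<le> inverse (real (Suc k))"
    for h :: "nat \<Rightarrow> 'a \<Rightarrow> 'b::euclidean_space" and l
  proof -
    define s where "s k x = indicator \<Omega> x *\<^sub>R (norm (h k x - l x))\<^sup>2" for k x
    have meas: "s k \<in> borel_measurable borel" for k
      unfolding s_def using \<Omega>(1)
      by (intro borel_measurable_continuous_on_indicator continuous_intros
          continuous_on_subset[OF h] continuous_on_subset[OF l]) auto
    have bd: "norm (s k x) \<le> (inverse (real (Suc k)))\<^sup>2" for k x
      using power_mono[OF b norm_ge_zero, of k x 2] by (auto simp: s_def indicator_def)
    have "(\<lambda>k. LINT x|lborel. s k x) \<longlonglongrightarrow> (LINT x::'a|lborel. 0)"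
    proof (rule tame_dominated_convergence[OF meas _ \<Omega>(2)])
      show "norm (s k x) \<le> 1" for k x
        using bd[of k x] power_le_one[of "inverse (real (Suc k))" 2]
        by (simp add: inverse_le_1_iff)
      show "s k x = 0" if "x \<notin> \<Omega>" for k x using that by (simp add: s_def)
      show "(\<lambda>k. s k x) \<longlonglongrightarrow> 0" for x
      proof (rule Lim_null_comparison)
        show "\<forall>\<^sub>F k in sequentially. norm (s k x) \<le> (inverse (real (Suc k)))\<^sup>2"
          using bd by simp
        show "(\<lambda>k. (inverse (real (Suc k)))\<^sup>2) \<longlonglongrightarrow> 0"
          using tendsto_power[OF LIMSEQ_inverse_real_of_nat, of 2] by simp
      qed
    qed
    moreover have "(LINT x:\<Omega>|lebesgue. (norm (h k x - l x))\<^sup>2) = (LINT x|lborel. s k x)" for k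
      by (rule set_lebesgue_integral_eq_lborel[OF meas]) (simp_all add: s_def)
    ultimately show ?thesis by simp
  qed
  have "smooth_on UNIV (\<psi> k)" for k using \<psi>(1) by (simp add: test_function_def)
  then have c: "continuous_on UNIV (\<psi> k)" "continuous_on UNIV (grad (\<psi> k))" for k
    using smooth_on_UNIV_derivative(3) smooth_gradient(2) by blast+
  have "(\<lambda>k. (LINT x:\<Omega>|lebesgue. (\<psi> k x - \<phi> x)\<^sup>2)) \<longlonglongrightarrow> 0"
    using lim[OF c(1) cont] \<psi>(2) by simp
  from tendsto_add[OF this lim[OF c(2) contG \<psi>(3)]]
  have "(\<lambda>k. (LINT x:\<Omega>|lebesgue. (\<psi> k x - \<phi> x)\<^sup>2)
      + (LINT x:\<Omega>|lebesgue. (norm (grad (\<psi> k) x - G x))\<^sup>2)) \<longlonglongrightarrow> 0" by simp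
  ultimately show ?thesis
    unfolding in_H10_def in_H1_def
    using \<psi>(1) in_L2_tame[OF t\<phi> \<Omega>(1) off(1)] in_L2_tame[OF tG \<Omega>(1) off(2)] by blast
qed

text \<open>Only the values of \<open>c\<close> on the closure of the support of \<open>g\<close> matter, and that closure is compact.\<close>

lemma tame_cont_scaleR:
  fixes c :: "'a::euclidean_space \<Rightarrow> real"
  assumes c: "continuous_on UNIV c" and g: "tame g"
  shows "tame (\<lambda>x. c x *\<^sub>R g x)"
proof -
  let ?S = "{x. g x \<noteq> 0}"
  have bS: "bounded ?S" using g by (simp add: tame_def)
  then have "compact (closure ?S)" by (simp add: compact_closure)
  then have "bounded (c ` closure ?S)"
    by (intro compact_imp_bounded compact_continuous_image continuous_on_subset[OF c]) auto
  then obtain B where "\<forall>y\<in>c ` closure ?S. norm y \<le> B" unfolding bounded_iff by blast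
  then have B: "\<bar>c x\<bar> \<le> B" if "g x \<noteq> 0" for x
    using closure_subset[of ?S] that by auto
  obtain C where C: "\<forall>x. norm (g x) \<le> C" using tame_bound[OF g] by blast
  show ?thesis
  proof (rule tameI[OF _ _ bS])
    show "(\<lambda>x. c x *\<^sub>R g x) \<in> borel_measurable borel"
      using borel_measurable_continuous_onI[OF c] tame_measurable[OF g] by simp
    show "norm (c x *\<^sub>R g x) \<le> \<bar>B\<bar> * \<bar>C\<bar>" for x
    proof (cases "g x = 0")
      case False
      have "norm (c x *\<^sub>R g x) = \<bar>c x\<bar> * norm (g x)" by simp
      also have "\<dots> \<le> \<bar>B\<bar> * \<bar>C\<bar>"
        using B[OF False] C by (intro mult_mono) (auto intro: order_trans[OF _ abs_ge_self])
      finally show ?thesis .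
    qed simp
    show "c x *\<^sub>R g x = 0" if "x \<notin> ?S" for x using that by simp
  qed
qed

lemma tame_cont_mult:
  fixes c g :: "'a::euclidean_space \<Rightarrow> real"
  assumes "continuous_on UNIV c" "tame g"
  shows "tame (\<lambda>x. c x * g x)"
  using tame_cont_scaleR[OF assms] by simp

section \<open>A continuously differentiable truncation\<close>

text \<open>For \<open>s > e\<close> this is \<open>s - 2 e + e\<^sup>2 / s\<close>. It cuts off a neighbourhood of zero, stays continuously
differentiable at the threshold, has slope in \<open>{0..1}\<close> on the half-line \<open>s \<ge> 0\<close>, and tends to \<open>s\<close> with slope tending to
one as \<open>e\<close> tends to zero.\<close>

definition soft_threshold :: "real \<Rightarrow> real \<Rightarrow> real" where
  "soft_threshold e s = (if s \<le> e then 0 else (s - e)\<^sup>2 / s)"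

definition soft_threshold' :: "real \<Rightarrow> real \<Rightarrow> real" where
  "soft_threshold' e s = (if s \<le> e then 0 else 1 - (e / s)\<^sup>2)"

lemma DERIV_soft_threshold:
  assumes "e > 0"
  shows "(soft_threshold e has_real_derivative soft_threshold' e s) (at s)"
proof (cases s e rule: linorder_cases)
  case less
  have "((\<lambda>_. 0) has_real_derivative 0) (at s)" by simp
  then have "(soft_threshold e has_real_derivative 0) (at s)"
    by (rule has_field_derivative_transform_within_open[where S="{..<e}"])
      (use less in \<open>auto simp: soft_threshold_def\<close>)
  with less show ?thesis by (simp add: soft_threshold'_def)
next
  case equal
  let ?q = "\<lambda>y. (soft_threshold e y - soft_threshold e e) / (y - e)"
  have "((\<lambda>y. (y - e) / y) \<longlongrightarrow> (e - e) / e) (at_right e)"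
    using assms by (intro tendsto_intros) auto
  then have "((\<lambda>y. (y - e) / y) \<longlongrightarrow> 0) (at_right e)" by simp
  moreover have "\<forall>\<^sub>F y in at_right e. (y - e) / y = ?q y"
    using assms by (auto simp: eventually_at_filter soft_threshold_def power2_eq_square)
  ultimately have "(?q \<longlongrightarrow> 0) (at_right e)" by (rule Lim_transform_eventually)
  moreover have "(?q \<longlongrightarrow> 0) (at_left e)"
    by (rule Lim_transform_eventually[OF tendsto_const])
      (auto simp: eventually_at_filter soft_threshold_def)
  ultimately have "(?q \<longlongrightarrow> 0) (at e)" by (simp add: filterlim_at_split)
  with equal show ?thesis by (simp add: has_field_derivative_iff soft_threshold'_def)
next
  case greater
  have "((\<lambda>s. (s - e)\<^sup>2 / s) has_real_derivative soft_threshold' e s) (at s)"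
    using greater assms
    by (auto intro!: derivative_eq_intros simp: soft_threshold'_def field_simps power2_eq_square)
  then show ?thesis
    by (rule has_field_derivative_transform_within_open[where S="{e<..}"])
      (use greater in \<open>auto simp: soft_threshold_def\<close>)
qed

lemma continuous_soft_threshold':
  assumes "e > 0" shows "continuous_on UNIV (soft_threshold' e)"
proof -
  have "continuous_on ({..e} \<union> {e..}) (\<lambda>s. if s \<le> e then 0 else 1 - (e / s)\<^sup>2)"
    by (rule continuous_on_If) (use assms in \<open>auto intro!: continuous_intros\<close>)
  moreover have "{..e} \<union> {e..} = UNIV" by auto
  ultimately show ?thesis unfolding soft_threshold'_def[abs_def] by simp
qed

lemma soft_threshold_bounds:
  assumes "e > 0" "s \<ge> 0"
  shows "0 \<le> soft_threshold e s" "soft_threshold e s \<le> s"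
    "0 \<le> soft_threshold' e s" "soft_threshold' e s \<le> 1"
proof -
  show "0 \<le> soft_threshold e s" using assms by (simp add: soft_threshold_def)
  show "soft_threshold' e s \<le> 1" by (simp add: soft_threshold'_def)
  show "soft_threshold e s \<le> s"
  proof (cases "s \<le> e")
    case False
    then have "(s - e)\<^sup>2 \<le> s\<^sup>2" using assms by (intro power_mono) auto
    then show ?thesis using False assms
      by (simp add: soft_threshold_def divide_le_eq power2_eq_square)
  qed (simp add: soft_threshold_def assms)
  show "0 \<le> soft_threshold' e s"
  proof (cases "s \<le> e")
    case False
    then have "(e / s)\<^sup>2 \<le> 1\<^sup>2" using assms by (intro power_mono) auto
    then show ?thesis by (simp add: soft_threshold'_def False)
  qed (simp add: soft_threshold'_def)
qed

lemma soft_threshold_tendsto: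
  assumes e: "e \<longlonglongrightarrow> 0" and s: "s > 0"
  shows "(\<lambda>n. soft_threshold (e n) s) \<longlonglongrightarrow> s" "(\<lambda>n. soft_threshold' (e n) s) \<longlonglongrightarrow> 1"
proof -
  have ev: "\<forall>\<^sub>F n in sequentially. e n < s" using e s by (rule order_tendstoD)
  have "(\<lambda>n. (s - e n)\<^sup>2 / s) \<longlonglongrightarrow> (s - 0)\<^sup>2 / s"
    using s by (intro tendsto_intros e) auto
  then have "(\<lambda>n. (s - e n)\<^sup>2 / s) \<longlonglongrightarrow> s" using s by (simp add: power2_eq_square)
  then show "(\<lambda>n. soft_threshold (e n) s) \<longlonglongrightarrow> s"
    by (rule Lim_transform_eventually)
      (use ev in eventually_elim, simp add: soft_threshold_def)
  have "(\<lambda>n. 1 - (e n / s)\<^sup>2) \<longlonglongrightarrow> 1 - (0 / s)\<^sup>2"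
    using s by (intro tendsto_intros e) auto
  then have "(\<lambda>n. 1 - (e n / s)\<^sup>2) \<longlonglongrightarrow> 1" by simp
  then show "(\<lambda>n. soft_threshold' (e n) s) \<longlonglongrightarrow> 1"
    by (rule Lim_transform_eventually)
      (use ev in eventually_elim, simp add: soft_threshold'_def)
qed

section \<open>The semilinear form of the equation\<close>

locale positive_weak_solution =
  fixes \<Omega> :: "'a::euclidean_space set" and \<theta> :: "real \<Rightarrow> real" and q lam :: real and u :: "'a \<Rightarrow> real"
  assumes open_\<Omega>: "open \<Omega>" and bounded_\<Omega>: "bounded \<Omega>" and nonempty_\<Omega>: "\<Omega> \<noteq> {}"
    and \<theta>_ge_1: "\<theta> s \<ge> 1"
    and C1_\<theta>: "\<theta> C1_differentiable_on UNIV"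
    and q_pos: "q > 0"
    and solution: "weak_solution \<theta> q lam \<Omega> u"
    and positive: "positive_in \<Omega> u"
begin

text \<open>\<open>U\<close> and \<open>DU\<close> extend \<open>u\<close> and its gradient by zero, so that all integrals run over the whole space and
dilations need no change of domain. \<open>\<Theta>\<close> is the primitive of \<open>sqrt \<theta>\<close> that vanishes at zero; integrating
from \<open>-1\<close> makes it two-sided differentiable at zero. \<open>V = \<Theta>(U)\<close> solves the semilinear equation
\<open>- \<Delta> V = lam f(U)\<close> in the weak sense, and \<open>W\<close> is its gradient.\<close>

definition U where "U x = (if x \<in> \<Omega> then u x else 0)"
definition DU where "DU x = (if x \<in> \<Omega> then grad u x else 0)"
definition \<Theta> where
  "\<Theta> s = integral {-1..s} (\<lambda>r. sqrt (\<theta> r)) - integral {-1..0} (\<lambda>r. sqrt (\<theta> r))"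
definition V where "V x = \<Theta> (U x)"
definition W where "W x = sqrt (\<theta> (U x)) *\<^sub>R DU x"
definition f where "f s = s powr q / sqrt (\<theta> s)"

lemma DERIV_\<theta>: "(\<theta> has_real_derivative deriv \<theta> s) (at s)"
  and continuous_deriv_\<theta>: "continuous_on UNIV (deriv \<theta>)"
proof -
  obtain D where D: "\<And>s. (\<theta> has_vector_derivative D s) (at s)" "continuous_on UNIV D"
    using C1_\<theta> unfolding C1_differentiable_on_def by blast
  then have D': "(\<theta> has_real_derivative D s) (at s)" for s
    by (simp add: has_real_derivative_iff_has_vector_derivative)
  then have "deriv \<theta> = D" by (intro ext DERIV_imp_deriv)
  with D' D(2) show "(\<theta> has_real_derivative deriv \<theta> s) (at s)" "continuous_on UNIV (deriv \<theta>)"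
    by auto
qed

lemma \<theta>_pos: "\<theta> s > 0" using \<theta>_ge_1[of s] by linarith

lemma continuous_\<theta>: "continuous_on UNIV \<theta>"
  using DERIV_\<theta> DERIV_isCont by (intro continuous_at_imp_continuous_on) blast

lemma \<Theta>_0: "\<Theta> 0 = 0" by (simp add: \<Theta>_def)

lemma DERIV_\<Theta>: assumes "s \<ge> 0" shows "(\<Theta> has_real_derivative sqrt (\<theta> s)) (at s)"
proof -
  have "((\<lambda>s. integral {-1..s} (\<lambda>r. sqrt (\<theta> r))) has_real_derivative sqrt (\<theta> s))
      (at s within {-1..s + 1})"
    by (rule integral_has_real_derivative)
      (use assms in \<open>auto intro!: continuous_intros continuous_on_subset[OF continuous_\<theta>]\<close>)
  then have "((\<lambda>s. integral {-1..s} (\<lambda>r. sqrt (\<theta> r))) has_real_derivative sqrt (\<theta> s)) (at s)"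
    using assms by (simp add: at_within_Icc_at)
  from DERIV_diff[OF this DERIV_const]
  show ?thesis unfolding \<Theta>_def[abs_def] by simp
qed

lemma continuous_on_\<Theta>: "continuous_on {0..} \<Theta>"
  using DERIV_\<Theta> DERIV_isCont by (intro continuous_at_imp_continuous_on) auto

lemma strict_mono_\<Theta>: assumes "0 \<le> r" "r < s" shows "\<Theta> r < \<Theta> s"
proof (rule DERIV_pos_imp_increasing[OF assms(2)])
  fix x assume "r \<le> x" "x \<le> s"
  then show "\<exists>y. (\<Theta> has_real_derivative y) (at x) \<and> 0 < y"
    using DERIV_\<Theta>[of x] \<theta>_pos[of x] assms(1) by (intro exI[of _ "sqrt (\<theta> x)"]) simp
qed

lemma \<Theta>_pos: "s > 0 \<Longrightarrow> \<Theta> s > 0"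
  using strict_mono_\<Theta>[of 0 s] \<Theta>_0 by simp

lemma u_C1:
  obtains D where "continuous_on (closure \<Omega>) D" "\<And>x. x \<in> \<Omega> \<Longrightarrow> GDERIV u x :> D x"
  using solution unfolding weak_solution_def C1_closure_def by blast

lemma GDERIV_U: assumes "x \<in> \<Omega>" shows "GDERIV U x :> DU x"
proof -
  obtain D where D: "\<And>x. x \<in> \<Omega> \<Longrightarrow> GDERIV u x :> D x" using u_C1 by metis
  then have "GDERIV u x :> DU x" using assms grad_eq[of u x "D x"] by (simp add: DU_def)
  then show ?thesis
    by (rule GDERIV_transform_open[OF _ open_\<Omega> assms]) (simp add: U_def)
qed

lemma continuous_on_DU: "continuous_on \<Omega> DU"
  and DU_bounded: "\<exists>L\<ge>0. \<forall>x. norm (DU x) \<le> L"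
proof -
  obtain D where D: "continuous_on (closure \<Omega>) D" "\<And>x. x \<in> \<Omega> \<Longrightarrow> GDERIV u x :> D x"
    using u_C1 by metis
  have eq: "DU x = D x" if "x \<in> \<Omega>" for x using that grad_eq[OF D(2)[OF that]] by (simp add: DU_def)
  have "continuous_on \<Omega> D" using continuous_on_subset[OF D(1) closure_subset] .
  then show "continuous_on \<Omega> DU" using eq by (simp cong: continuous_on_cong)
  have "bounded (D ` closure \<Omega>)"
    using bounded_\<Omega> by (intro compact_imp_bounded compact_continuous_image D(1)) (simp add: compact_closure)
  then obtain L where L: "\<forall>y\<in>D ` closure \<Omega>. norm y \<le> L" unfolding bounded_iff by blast
  have "norm (DU x) \<le> max L 0" for x
  proof (cases "x \<in> \<Omega>")
    case True
    then have "x \<in> closure \<Omega>" using closure_subset by blast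
    then show ?thesis using L eq[OF True] by (simp add: le_max_iff_disj)
  qed (simp add: DU_def)
  then show "\<exists>L\<ge>0. \<forall>x. norm (DU x) \<le> L" by (intro exI[of _ "max L 0"]) simp
qed

lemma U_pos_iff: "U x > 0 \<longleftrightarrow> x \<in> \<Omega>"
  using positive by (auto simp: U_def positive_in_def)

lemma U_nonneg: "U x \<ge> 0"
  using U_pos_iff[of x] by (cases "x \<in> \<Omega>") (auto simp: U_def)

text \<open>Continuity across the boundary is where the boundary condition enters.\<close>

lemma continuous_U: "continuous_on UNIV U"
proof -
  have u: "continuous_on (closure \<Omega>) u" "\<And>x. x \<in> frontier \<Omega> \<Longrightarrow> u x = 0"
    using solution by (auto simp: weak_solution_def C1_closure_def)
  have "continuous_on (closure \<Omega> \<union> - \<Omega>) (\<lambda>x. if x \<in> closure \<Omega> then u x else 0)"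
    by (rule continuous_on_If)
      (use u open_\<Omega> in \<open>auto simp: frontier_def interior_open closed_Compl\<close>)
  moreover have "closure \<Omega> \<union> - \<Omega> = UNIV" using closure_subset by blast
  moreover have "(\<lambda>x. if x \<in> closure \<Omega> then u x else 0) = U"
    using u(2) open_\<Omega> closure_subset[of \<Omega>]
    by (auto simp: fun_eq_iff U_def frontier_def interior_open)
  ultimately show ?thesis by metis
qed

lemma tame_U: "tame U"
  by (rule tame_continuous[OF continuous_U bounded_\<Omega>]) (simp add: U_def)

lemma tame_DU: "tame DU"
proof -
  obtain L where "\<forall>x. norm (DU x) \<le> L" using DU_bounded by blast
  then show ?thesis
    by (intro tame_continuous_on_open[OF open_\<Omega> bounded_\<Omega> continuous_on_DU, of L])
      (simp, simp add: DU_def)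
qed

lemma continuous_compose_U: "continuous_on UNIV g \<Longrightarrow> continuous_on UNIV (\<lambda>x. g (U x))"
  by (rule continuous_on_compose2[OF _ continuous_U]) auto

lemma continuous_sqrt_\<theta>: "continuous_on UNIV (\<lambda>s. sqrt (\<theta> s))"
  by (intro continuous_intros continuous_\<theta>)

lemma tame_W: "tame W"
  unfolding W_def[abs_def]
  by (rule tame_cont_scaleR[OF continuous_compose_U[OF continuous_sqrt_\<theta>] tame_DU])

lemma continuous_on_W: "continuous_on \<Omega> W"
  unfolding W_def[abs_def]
  by (intro continuous_intros continuous_on_DU
      continuous_on_subset[OF continuous_compose_U[OF continuous_\<theta>]]) simp

lemma continuous_powr: "r > 0 \<Longrightarrow> continuous_on {0..} (\<lambda>s::real. s powr r)"
  by (rule continuous_on_powr') (auto intro!: continuous_intros)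

lemma continuous_fU: "continuous_on UNIV (\<lambda>x. f (U x))"
proof -
  have "continuous_on UNIV (\<lambda>x. U x powr q)"
    by (rule continuous_on_compose2[OF continuous_powr[OF q_pos] continuous_U]) (auto simp: U_nonneg)
  moreover have "sqrt (\<theta> (U x)) \<noteq> 0" for x using \<theta>_pos[of "U x"] by simp
  ultimately show ?thesis
    unfolding f_def using continuous_compose_U[OF continuous_sqrt_\<theta>]
    by (intro continuous_on_divide) auto
qed

lemma fU_nonneg: "f (U x) \<ge> 0" using \<theta>_pos by (simp add: f_def less_imp_le)

text \<open>Testing the equation with \<open>\<phi> = Z / sqrt (\<theta> (U))\<close>, the derivative of \<open>1 / sqrt (\<theta> (U))\<close> produces exactly the term
that cancels \<open>1/2 \<theta>'(u) |\<nabla>u|\<^sup>2 \<phi>\<close>.\<close>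

lemma semilinear_identity_compact_support:
  assumes K: "compact K" "K \<subseteq> \<Omega>" "\<And>x. x \<notin> K \<Longrightarrow> Z x = 0"
    and der: "\<And>x. GDERIV Z x :> H x" and contH: "continuous_on UNIV H"
  shows "(LINT x|lborel. W x \<bullet> H x) = lam * (LINT x|lborel. f (U x) * Z x)"
proof -
  have K': "closed K" "bounded K"
    using K(1) compact_imp_closed compact_imp_bounded by blast+
  have H0: "H x = 0" if "x \<notin> K" for x
    by (rule gradient_eq_0_off_support[OF der K'(1) K(3) that])
  have contZ: "continuous_on UNIV Z"
    using GDERIV_continuous[OF der] by (intro continuous_at_imp_continuous_on) blast
  have tZ: "tame Z" by (rule tame_continuous[OF contZ K'(2) K(3)])
  have tH: "tame H" by (rule tame_continuous[OF contH K'(2) H0])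
  define r where "r s = inverse (sqrt (\<theta> s))" for s
  define r' where "r' s = - deriv \<theta> s / (2 * \<theta> s * sqrt (\<theta> s))" for s
  have r: "(r has_real_derivative r' s) (at s)" for s
    unfolding r_def r'_def using \<theta>_pos[of s] DERIV_\<theta>[of s]
    by (auto intro!: derivative_eq_intros simp: field_simps power2_eq_square)
  have contr: "continuous_on UNIV r"
    using r DERIV_isCont by (intro continuous_at_imp_continuous_on) blast
  have contr': "continuous_on UNIV r'"
    unfolding r'_def[abs_def] using \<theta>_pos
    by (intro continuous_intros continuous_\<theta> continuous_deriv_\<theta>) (auto simp: less_imp_neq[symmetric])
  define \<phi> where "\<phi> x = Z x * r (U x)" for x
  define G where "G x = Z x *\<^sub>R (r' (U x) *\<^sub>R DU x) + r (U x) *\<^sub>R H x" for x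
  have \<phi>0: "\<phi> x = 0" if "x \<notin> K" for x using K(3)[OF that] by (simp add: \<phi>_def)
  have G0: "G x = 0" if "x \<notin> K" for x using K(3)[OF that] H0[OF that] by (simp add: G_def)
  have d\<phi>: "GDERIV \<phi> x :> G x" for x
  proof (cases "x \<in> \<Omega>")
    case True
    show ?thesis unfolding \<phi>_def[abs_def] G_def
      by (rule GDERIV_mult[OF der GDERIV_DERIV_compose[OF GDERIV_U[OF True] r]])
  next
    case False
    then have "x \<in> - K" using K(2) by auto
    then show ?thesis
      using GDERIV_eq_0_of_locally_0[of "- K" x \<phi>] K'(1) \<phi>0 G0 by auto
  qed
  have contG: "continuous_on UNIV G"
  proof -
    have "continuous_on \<Omega> G"
      unfolding G_def[abs_def]
      by (intro continuous_intros continuous_on_subset[OF contZ] continuous_on_subset[OF contH]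
          continuous_on_subset[OF continuous_compose_U[OF contr]]
          continuous_on_subset[OF continuous_compose_U[OF contr']] continuous_on_DU) auto
    moreover have "continuous_on (- K) G"
      by (rule continuous_on_eq[OF continuous_on_const[of _ 0]]) (simp add: G0)
    ultimately have "continuous_on (\<Omega> \<union> - K) G"
      using open_\<Omega> K'(1) by (intro continuous_on_open_Un) auto
    moreover have "\<Omega> \<union> - K = UNIV" using K(2) by auto
    ultimately show ?thesis by simp
  qed
  have "in_H10 \<Omega> \<phi> G"
    by (rule C1_compact_support_in_H10[OF open_\<Omega> bounded_\<Omega> K(1,2) \<phi>0 d\<phi> contG])
  then have weak: "(LINT x:\<Omega>|lebesgue. \<theta> (u x) * (grad u x \<bullet> G x))
        + 1/2 * (LINT x:\<Omega>|lebesgue. deriv \<theta> (u x) * (norm (grad u x))\<^sup>2 * \<phi> x)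
        = lam * (LINT x:\<Omega>|lebesgue. \<bar>u x\<bar> powr (q - 1) * u x * \<phi> x)"
    using solution unfolding weak_solution_def by blast
  have contPhi: "continuous_on UNIV \<phi>"
    using GDERIV_continuous[OF d\<phi>] by (intro continuous_at_imp_continuous_on) blast
  have t\<phi>: "tame \<phi>" by (rule tame_continuous[OF contPhi K'(2) \<phi>0])
  have tG: "tame G" by (rule tame_continuous[OF contG K'(2) G0])
  have tA: "tame (\<lambda>x. \<theta> (U x) * (DU x \<bullet> G x))"
    by (rule tame_cont_mult[OF continuous_compose_U[OF continuous_\<theta>] tame_inner[OF tame_DU tG]])
  have tB: "tame (\<lambda>x. deriv \<theta> (U x) * ((norm (DU x))\<^sup>2 * \<phi> x))"
    by (rule tame_cont_mult[OF continuous_compose_U[OF continuous_deriv_\<theta>]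
          tame_mult[OF tame_norm_sq[OF tame_DU] t\<phi>]])
  have tC: "tame (\<lambda>x. f (U x) * Z x)" by (rule tame_cont_mult[OF continuous_fU tZ])
  have A: "(LINT x:\<Omega>|lebesgue. \<theta> (u x) * (grad u x \<bullet> G x)) = (LINT x|lborel. \<theta> (U x) * (DU x \<bullet> G x))"
    by (rule set_lebesgue_integral_eq_lborel[OF tame_measurable[OF tA]]) (simp_all add: U_def DU_def)
  have B: "(LINT x:\<Omega>|lebesgue. deriv \<theta> (u x) * (norm (grad u x))\<^sup>2 * \<phi> x)
      = (LINT x|lborel. deriv \<theta> (U x) * ((norm (DU x))\<^sup>2 * \<phi> x))"
    by (rule set_lebesgue_integral_eq_lborel[OF tame_measurable[OF tB]]) (simp_all add: U_def DU_def)
  have C: "(LINT x:\<Omega>|lebesgue. \<bar>u x\<bar> powr (q - 1) * u x * \<phi> x) = (LINT x|lborel. f (U x) * Z x)"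
  proof (rule set_lebesgue_integral_eq_lborel[OF tame_measurable[OF tC]])
    fix x assume x: "x \<in> \<Omega>"
    then have "u x > 0" using positive by (simp add: positive_in_def)
    then have "\<bar>u x\<bar> powr (q - 1) * u x = u x powr q" by (simp add: powr_diff)
    then show "\<bar>u x\<bar> powr (q - 1) * u x * \<phi> x = f (U x) * Z x"
      using x by (simp add: \<phi>_def f_def r_def U_def field_simps)
  next
    fix x assume "x \<notin> \<Omega>"
    then show "f (U x) * Z x = 0" using K by auto
  qed
  have "\<theta> (U x) * (DU x \<bullet> G x) + 1/2 * (deriv \<theta> (U x) * ((norm (DU x))\<^sup>2 * \<phi> x)) = W x \<bullet> H x" for x
  proof -
    let ?c = "sqrt (\<theta> (U x))"
    have c: "?c > 0" "\<theta> (U x) = ?c * ?c" using \<theta>_pos[of "U x"] by auto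
    have "\<theta> (U x) * r' (U x) = - deriv \<theta> (U x) / (2 * ?c)" "\<theta> (U x) * r (U x) = ?c"
      unfolding r'_def r_def using c by (simp_all add: field_simps)
    moreover have "\<theta> (U x) * (DU x \<bullet> G x)
        = Z x * (norm (DU x))\<^sup>2 * (\<theta> (U x) * r' (U x)) + (\<theta> (U x) * r (U x)) * (DU x \<bullet> H x)"
      by (simp add: G_def inner_add_right dot_square_norm algebra_simps)
    ultimately have "\<theta> (U x) * (DU x \<bullet> G x)
        = Z x * (norm (DU x))\<^sup>2 * (- deriv \<theta> (U x) / (2 * ?c)) + ?c * (DU x \<bullet> H x)" by simp
    moreover have "1/2 * (deriv \<theta> (U x) * ((norm (DU x))\<^sup>2 * \<phi> x))
        = Z x * (norm (DU x))\<^sup>2 * (deriv \<theta> (U x) / (2 * ?c))"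
      by (simp add: \<phi>_def r_def field_simps)
    ultimately show ?thesis by (simp add: W_def)
  qed
  then have "(LINT x|lborel. W x \<bullet> H x)
      = (LINT x|lborel. \<theta> (U x) * (DU x \<bullet> G x) + 1/2 * (deriv \<theta> (U x) * ((norm (DU x))\<^sup>2 * \<phi> x)))"
    by simp
  also have "\<dots> = (LINT x|lborel. \<theta> (U x) * (DU x \<bullet> G x))
      + (LINT x|lborel. 1/2 * (deriv \<theta> (U x) * ((norm (DU x))\<^sup>2 * \<phi> x)))"
    using tame_integrable[OF tA] tame_integrable[OF tB]
    by (intro Bochner_Integration.integral_add) auto
  also have "\<dots> = lam * (LINT x|lborel. f (U x) * Z x)"
    using weak unfolding A B C by simp
  finally show ?thesis .
qed

text \<open>Functions that are differentiable only inside a subset \<open>S\<close> are admissible too. Truncating \<open>w\<close> near zero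
gives compact support inside \<open>S\<close>, and the truncations and their gradients converge boundedly. This
covers both \<open>V\<close> and its contractions, which have a kink along the boundary of \<open>S\<close>.\<close>

lemma semilinear_identity:
  assumes S: "open S" "S \<subseteq> \<Omega>" and w: "continuous_on UNIV w" "\<And>x. x \<in> S \<Longrightarrow> w x > 0"
      "\<And>x. x \<notin> S \<Longrightarrow> w x = 0"
    and der: "\<And>x. x \<in> S \<Longrightarrow> GDERIV w x :> H x" and H: "continuous_on S H" "tame H"
      "\<And>x. x \<notin> S \<Longrightarrow> H x = 0"
  shows "(LINT x|lborel. W x \<bullet> H x) = lam * (LINT x|lborel. f (U x) * w x)"
proof -
  have bS: "bounded S" using bounded_subset[OF bounded_\<Omega> S(2)] .
  have w0: "w x \<ge> 0" for x using w(2,3)[of x] by (cases "x \<in> S") auto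
  have tw: "tame w" by (rule tame_continuous[OF w(1) bS w(3)])
  define e where "e n = inverse (real (Suc n))" for n
  have e: "e n > 0" for n by (simp add: e_def)
  have e0: "e \<longlonglongrightarrow> 0" unfolding e_def by (rule LIMSEQ_inverse_real_of_nat)
  define Z where "Z n x = soft_threshold (e n) (w x)" for n x
  define HZ where "HZ n x = soft_threshold' (e n) (w x) *\<^sub>R H x" for n x
  have contZ': "continuous_on UNIV (\<lambda>x. soft_threshold' (e n) (w x))" for n
    by (rule continuous_on_compose2[OF continuous_soft_threshold'[OF e] w(1)]) auto
  have contst: "continuous_on UNIV (soft_threshold (e n))" for n
    using DERIV_soft_threshold[OF e] DERIV_isCont by (intro continuous_at_imp_continuous_on) blast
  have tZ: "tame (Z n)" for n
    unfolding Z_def[abs_def]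
    by (rule tame_compose[OF tw contst]) (simp add: soft_threshold_def e less_imp_le)
  have tHZ: "tame (HZ n)" for n
    unfolding HZ_def[abs_def] by (rule tame_cont_scaleR[OF contZ' H(2)])
  have id: "(LINT x|lborel. W x \<bullet> HZ n x) = lam * (LINT x|lborel. f (U x) * Z n x)" for n
  proof (rule semilinear_identity_compact_support)
    let ?K = "{x. e n \<le> w x}"
    have KS: "?K \<subseteq> S" using w(3) e[of n] by force
    have "closed ?K" by (intro closed_Collect_le continuous_intros w(1))
    then show "compact ?K" using bounded_subset[OF bS KS] by (simp add: compact_eq_bounded_closed)
    show "?K \<subseteq> \<Omega>" using KS S(2) by blast
    show "Z n x = 0" if "x \<notin> ?K" for x using that by (simp add: Z_def soft_threshold_def)
    have opL: "open {x. w x < e n}" by (intro open_Collect_less continuous_intros w(1))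
    show "GDERIV (Z n) x :> HZ n x" for x
    proof (cases "x \<in> S")
      case True
      show ?thesis unfolding Z_def[abs_def] HZ_def
        by (rule GDERIV_DERIV_compose[OF der[OF True] DERIV_soft_threshold[OF e]])
    next
      case False
      have "GDERIV (Z n) x :> 0"
        by (rule GDERIV_eq_0_of_locally_0[OF opL])
          (use w(3)[OF False] e[of n] in \<open>auto simp: Z_def soft_threshold_def\<close>)
      then show ?thesis by (simp add: HZ_def H(3)[OF False])
    qed
    have "continuous_on S (HZ n)"
      unfolding HZ_def[abs_def] by (intro continuous_intros H(1) continuous_on_subset[OF contZ']) simp
    moreover have "continuous_on {x. w x < e n} (HZ n)"
      by (rule continuous_on_eq[OF continuous_on_const[of _ 0]]) (simp add: HZ_def soft_threshold'_def)
    ultimately have "continuous_on (S \<union> {x. w x < e n}) (HZ n)"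
      using S(1) opL by (intro continuous_on_open_Un)
    moreover have "S \<union> {x. w x < e n} = UNIV" using w(3) e[of n] by auto
    ultimately show "continuous_on UNIV (HZ n)" by simp
  qed
  obtain CW where CW: "CW \<ge> 0" "\<forall>x. norm (W x) \<le> CW" using tame_bound[OF tame_W] by blast
  obtain CH where CH: "CH \<ge> 0" "\<forall>x. norm (H x) \<le> CH" using tame_bound[OF H(2)] by blast
  have tfw: "tame (\<lambda>x. f (U x) * w x)" by (rule tame_cont_mult[OF continuous_fU tw])
  obtain Cf where Cf: "\<forall>x. norm (f (U x) * w x) \<le> Cf" using tame_bound[OF tfw] by blast
  have "(\<lambda>n. LINT x|lborel. W x \<bullet> HZ n x) \<longlonglongrightarrow> (LINT x|lborel. W x \<bullet> H x)"
  proof (rule tame_dominated_convergence[OF _ _ bS])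
    show "(\<lambda>x. W x \<bullet> HZ n x) \<in> borel_measurable borel" for n
      by (rule tame_measurable[OF tame_inner[OF tame_W tHZ]])
    show "norm (W x \<bullet> HZ n x) \<le> CW * CH" for n x
    proof -
      have "norm (W x \<bullet> HZ n x) \<le> norm (W x) * norm (HZ n x)"
        using Cauchy_Schwarz_ineq2 by simp
      also have "\<dots> \<le> CW * CH"
      proof (rule mult_mono)
        have "norm (HZ n x) \<le> 1 * norm (H x)"
          unfolding HZ_def norm_scaleR
          using soft_threshold_bounds[OF e w0] by (intro mult_right_mono) auto
        then show "norm (HZ n x) \<le> CH" using CH(2) by (auto intro: order_trans)
      qed (use CW in auto)
      finally show ?thesis .
    qed
    show "W x \<bullet> HZ n x = 0" if "x \<notin> S" for n x using H(3)[OF that] by (simp add: HZ_def)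
    show "(\<lambda>n. W x \<bullet> HZ n x) \<longlonglongrightarrow> W x \<bullet> H x" for x
    proof (cases "x \<in> S")
      case True
      have "(\<lambda>n. W x \<bullet> HZ n x) \<longlonglongrightarrow> W x \<bullet> (1 *\<^sub>R H x)"
        unfolding HZ_def by (intro tendsto_intros soft_threshold_tendsto e0 w(2) True)
      then show ?thesis by simp
    qed (simp add: HZ_def H(3))
  qed
  moreover have "(\<lambda>n. LINT x|lborel. f (U x) * Z n x) \<longlonglongrightarrow> (LINT x|lborel. f (U x) * w x)"
  proof (rule tame_dominated_convergence[OF _ _ bS])
    show "(\<lambda>x. f (U x) * Z n x) \<in> borel_measurable borel" for n
      by (rule tame_measurable[OF tame_cont_mult[OF continuous_fU tZ]])
    have Zb: "0 \<le> Z n x" "Z n x \<le> w x" for n x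
      using soft_threshold_bounds[OF e w0] by (auto simp: Z_def)
    show "norm (f (U x) * Z n x) \<le> Cf" for n x
    proof -
      have "norm (f (U x) * Z n x) \<le> f (U x) * w x"
        using fU_nonneg[of x] Zb[of n x] by (simp add: abs_mult mult_left_mono)
      also have "\<dots> \<le> Cf" using Cf abs_ge_self order_trans by (metis real_norm_def)
      finally show ?thesis .
    qed
    have Z0: "Z n x = 0" if "x \<notin> S" for n x using Zb[of n x] w(3)[OF that] by simp
    then show "f (U x) * Z n x = 0" if "x \<notin> S" for n x using that by simp
    show "(\<lambda>n. f (U x) * Z n x) \<longlonglongrightarrow> f (U x) * w x" for x
    proof (cases "x \<in> S")
      case True
      show ?thesis unfolding Z_def by (intro tendsto_intros soft_threshold_tendsto e0 w(2) True)
    qed (simp add: Z0 w(3))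
  qed
  ultimately have "(\<lambda>n. lam * (LINT x|lborel. f (U x) * Z n x)) \<longlonglongrightarrow> (LINT x|lborel. W x \<bullet> H x)"
    "(\<lambda>n. lam * (LINT x|lborel. f (U x) * Z n x)) \<longlonglongrightarrow> lam * (LINT x|lborel. f (U x) * w x)"
    unfolding id by (auto intro: tendsto_intros)
  then show ?thesis by (rule LIMSEQ_unique)
qed

end

section \<open>A Pohozaev inequality by dilation\<close>

lemma DERIV_at_1_sequence:
  assumes "(g has_real_derivative D) (at 1)" "h \<longlonglongrightarrow> 0" "\<And>n. h n > (0::real)"
  shows "(\<lambda>n. (g (1 + h n) - g 1) / h n) \<longlonglongrightarrow> D"
proof -
  have "((\<lambda>t. (g (1 + t) - g 1) / t) \<longlongrightarrow> D) (at 0)"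
    using assms(1) by (simp add: DERIV_def)
  moreover have "filterlim h (at 0) sequentially"
    using assms(2,3) by (simp add: filterlim_at less_imp_neq[symmetric])
  ultimately show ?thesis by (rule filterlim_compose)
qed

context positive_weak_solution
begin

text \<open>On a segment inside \<open>\<Omega>\<close> this is the mean value inequality. A segment that leaves \<open>\<Omega>\<close> is cut at the points
where it first does so from either end: there \<open>U\<close> vanishes.\<close>

lemma U_lipschitz:
  assumes L: "\<And>x. norm (DU x) \<le> L"
  shows "\<bar>U x - U y\<bar> \<le> L * norm (x - y)"
proof -
  have inner: "\<bar>U x - U y\<bar> \<le> L * norm (x - y)" if "closed_segment x y \<subseteq> \<Omega>" for x y
    by (rule GDERIV_lipschitz[of "closed_segment x y" U DU])
      (use that L GDERIV_U in auto)
  have L0: "L \<ge> 0" using L norm_ge_zero order_trans by blast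
  have bound: "U x \<le> L * norm (x - y)" if y: "y \<notin> \<Omega>" for x y
  proof (cases "x \<in> \<Omega>")
    case False
    then show ?thesis using L0 by (simp add: U_def)
  next
    case True
    define A where "A = closed_segment x y - \<Omega>"
    have "compact A" unfolding A_def by (rule compact_diff) (use open_\<Omega> in auto)
    moreover have "A \<noteq> {}" using y by (auto simp: A_def)
    ultimately obtain z where z: "z \<in> A" "\<And>a. a \<in> A \<Longrightarrow> dist x z \<le> dist x a"
      using distance_attains_inf[of A x] compact_imp_closed by blast
    have zx: "z \<noteq> x" using z(1) True by (auto simp: A_def)
    have zseg: "z \<in> closed_segment x y" "z \<notin> \<Omega>" using z(1) by (auto simp: A_def)
    \<comment> \<open>\<open>z\<close> is the first exit point. It lies outside \<open>\<Omega>\<close>, so the mean value inequality is used up to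
      points \<open>p n\<close> before \<open>z\<close> and extended by continuity.\<close>
    define p where "p n = z + inverse (real (Suc n)) *\<^sub>R (x - z)" for n
    have pz: "p \<longlonglongrightarrow> z"
    proof -
      have "p \<longlonglongrightarrow> z + 0 *\<^sub>R (x - z)"
        unfolding p_def by (intro tendsto_intros LIMSEQ_inverse_real_of_nat)
      then show ?thesis by simp
    qed
    have seg: "closed_segment x (p n) \<subseteq> \<Omega>" for n
    proof
      fix b assume b: "b \<in> closed_segment x (p n)"
      have "p n \<in> closed_segment x z"
        unfolding p_def in_segment
        by (intro exI[of _ "1 - inverse (real (Suc n))"]) (auto simp: algebra_simps inverse_le_1_iff)
      then have bxz: "b \<in> closed_segment x z"
        using b closed_segment_subset[of x "closed_segment x z" "p n"] by auto
      then have "b \<in> closed_segment x y"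
        using zseg(1) closed_segment_subset[of x "closed_segment x y" z] by auto
      moreover have "dist x b < dist x z"
      proof -
        have "dist x b \<le> dist x (p n)"
          using segment_bound(1)[OF b] by (simp add: dist_norm norm_minus_commute)
        also have "dist x (p n) = (1 - inverse (real (Suc n))) * dist x z"
        proof -
          have "x - p n = (1 - inverse (real (Suc n))) *\<^sub>R (x - z)"
            by (simp add: p_def algebra_simps)
          moreover have "1 - inverse (real (Suc n)) \<ge> 0" by (simp add: inverse_le_1_iff)
          ultimately show ?thesis by (simp add: dist_norm)
        qed
        also have "\<dots> < 1 * dist x z" using zx by (intro mult_strict_right_mono) auto
        finally show ?thesis by simp
      qed
      ultimately show "b \<in> \<Omega>" using z(2)[of b] by (fastforce simp: A_def)
    qed
    have "(\<lambda>n. \<bar>U x - U (p n)\<bar>) \<longlonglongrightarrow> \<bar>U x - U z\<bar>"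
      by (intro tendsto_intros continuous_on_tendsto_compose[OF continuous_U pz]) auto
    moreover have "(\<lambda>n. L * norm (x - p n)) \<longlonglongrightarrow> L * norm (x - z)"
      by (intro tendsto_intros pz)
    ultimately have "\<bar>U x - U z\<bar> \<le> L * norm (x - z)"
      by (rule LIMSEQ_le) (use inner[OF seg] in auto)
    also have "\<dots> \<le> L * norm (x - y)"
      using segment_bound(1)[OF zseg(1)] L0 by (intro mult_left_mono) (auto simp: norm_minus_commute)
    finally show ?thesis using zseg(2) by (simp add: U_def)
  qed
  show ?thesis
  proof (cases "closed_segment x y \<subseteq> \<Omega>")
    case True then show ?thesis by (rule inner)
  next
    case False
    then obtain z where z: "z \<in> closed_segment x y" "z \<notin> \<Omega>" by blast
    have "U x \<le> L * norm (x - z)" "U y \<le> L * norm (y - z)" using bound[OF z(2)] by auto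
    moreover have "norm (x - z) \<le> norm (x - y)" "norm (y - z) \<le> norm (x - y)"
      using segment_bound[OF z(1)] by (auto simp: norm_minus_commute)
    then have "L * norm (x - z) \<le> L * norm (x - y)" "L * norm (y - z) \<le> L * norm (x - y)"
      using L0 by (auto intro: mult_left_mono)
    ultimately show ?thesis using U_nonneg[of x] U_nonneg[of y] by linarith
  qed
qed

lemma continuous_V: "continuous_on UNIV V"
  unfolding V_def[abs_def]
  by (rule continuous_on_compose2[OF continuous_on_\<Theta> continuous_U]) (auto simp: U_nonneg)

lemma V_pos: "x \<in> \<Omega> \<Longrightarrow> V x > 0"
  using \<Theta>_pos U_pos_iff by (simp add: V_def)

lemma V_0: "x \<notin> \<Omega> \<Longrightarrow> V x = 0"
  by (simp add: V_def U_def \<Theta>_0)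

lemma W_0: "x \<notin> \<Omega> \<Longrightarrow> W x = 0"
  by (simp add: W_def DU_def)

lemma tame_V: "tame V"
  by (rule tame_continuous[OF continuous_V bounded_\<Omega> V_0])

lemma GDERIV_V: assumes "x \<in> \<Omega>" shows "GDERIV V x :> W x"
  unfolding V_def[abs_def] W_def
  by (rule GDERIV_DERIV_compose[OF GDERIV_U[OF assms] DERIV_\<Theta>[OF U_nonneg]])

definition energy where "energy = (LINT x|lborel. (norm (W x))\<^sup>2)"

text \<open>The semilinear equation tested with \<open>V\<close> itself.\<close>

lemma energy_identity: "energy = lam * (LINT x|lborel. f (U x) * V x)"
  using semilinear_identity[OF open_\<Omega> order_refl continuous_V V_pos V_0 GDERIV_V continuous_on_W tame_W W_0]
  by (simp add: energy_def dot_square_norm)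

definition F where "F s = s powr (q + 1) / (q + 1)"

lemma DERIV_F: assumes "s > 0" shows "(F has_real_derivative s powr q) (at s)"
  using DERIV_cdivide[OF has_real_derivative_powr[OF assms, of "q + 1"], of "q + 1"] q_pos
  by (simp add: F_def[abs_def])

lemma F_0: "F 0 = 0" by (simp add: F_def)

lemma continuous_on_F: "continuous_on {0..} F"
  unfolding F_def[abs_def] using q_pos by (intro continuous_intros continuous_powr) auto

lemma tame_FU: "tame (\<lambda>x. F (U x))"
proof (rule tame_continuous[OF _ bounded_\<Omega>])
  show "continuous_on UNIV (\<lambda>x. F (U x))"
    by (rule continuous_on_compose2[OF continuous_on_F continuous_U]) (auto simp: U_nonneg)
qed (simp add: U_def F_0)

lemma abs_diff_le_of_bounded_deriv:
  assumes cont: "continuous_on {0..} g" and der: "\<And>s. s > 0 \<Longrightarrow> (g has_real_derivative g' s) (at s)"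
    and g': "\<And>s. 0 < s \<Longrightarrow> s \<le> M \<Longrightarrow> \<bar>g' s\<bar> \<le> C" and rs: "0 \<le> r" "r \<le> M" "0 \<le> s" "s \<le> M"
  shows "\<bar>g r - g s\<bar> \<le> C * \<bar>r - s\<bar>"
proof -
  have less: "\<bar>g b - g a\<bar> \<le> C * (b - a)" if ab: "0 \<le> a" "a < b" "b \<le> M" for a b
  proof -
    have "continuous_on {a..b} g" by (rule continuous_on_subset[OF cont]) (use ab(1) in auto)
    moreover have "g differentiable (at x)" if "a < x" for x
      using der[of x] that ab(1) by (auto simp: real_differentiable_def)
    ultimately obtain l z where z: "a < z" "z < b" "(g has_real_derivative l) (at z)"
        "g b - g a = (b - a) * l"
      using MVT[OF ab(2)] by metis
    then have "l = g' z" using DERIV_unique der[of z] ab(1) by simp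
    then have "\<bar>l\<bar> \<le> C" using g'[of z] z ab by simp
    then show ?thesis using ab(2) z(4) by (simp add: abs_mult mult.commute mult_right_mono)
  qed
  show ?thesis
    using less[of r s] less[of s r] rs by (cases r s rule: linorder_cases) (auto simp: abs_minus_commute)
qed

text \<open>Let \<open>T t\<close> be the dilation by \<open>t > 1\<close> about the centre \<open>a\<close>. Since \<open>\<Omega>\<close> is starlike, \<open>V \<circ> T t\<close> vanishes off a
subset of \<open>\<Omega>\<close> and is an admissible test function. Testing with \<open>V \<circ> T t - V\<close> and applying
\<open>2 v \<bullet> w \<le> |v|\<^sup>2 + |w|\<^sup>2\<close> bounds \<open>lam \<integral> f(U) (V \<circ> T t - V)\<close> by half the difference of the energies of \<open>V \<circ> T t\<close> and
\<open>V\<close>, which scaling evaluates to \<open>(t\<^sup>2 / t\<^sup>N - 1) / 2\<close> times the energy. After division by \<open>t - 1\<close>, as \<open>t\<close> tends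
to one, the left side becomes \<open>lam\<close> times the derivative of \<open>\<integral> F(U \<circ> T t) = t\<^sup>-\<^sup>N \<integral> F(U)\<close>, because \<open>f\<close> is the derivative of
\<open>F\<close> with respect to \<open>\<Theta>\<close>. The classical identity contains in addition the boundary integral of
\<open>|\<nabla>V|\<^sup>2 (x - a) \<bullet> \<nu>\<close>; it is nonnegative on a starlike domain, and the inequality drops it.\<close>

lemma pohozaev_inequality:
  assumes a: "\<And>x. x \<in> \<Omega> \<Longrightarrow> closed_segment a x \<subseteq> \<Omega>"
  shows "(real DIM('a) - 2) / 2 * energy \<le> real DIM('a) * lam * (LINT x|lborel. F (U x))"
proof -
  let ?N = "DIM('a)"
  define T where "T t x = a + t *\<^sub>R (x - a)" for t x
  have T_in: "x \<in> \<Omega>" if "t \<ge> 1" "T t x \<in> \<Omega>" for t x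
  proof -
    have "x = (1 - inverse t) *\<^sub>R a + inverse t *\<^sub>R T t x"
      using that(1) by (simp add: T_def algebra_simps)
    moreover have "0 \<le> inverse t" "inverse t \<le> 1" using that(1) by (auto simp: inverse_le_1_iff)
    ultimately have "x \<in> closed_segment a (T t x)" unfolding in_segment by blast
    then show ?thesis using a[OF that(2)] by blast
  qed
  have contT: "continuous_on UNIV (T t)" for t unfolding T_def by (intro continuous_intros)
  have dilate: "(LINT x|lborel. W x \<bullet> (t *\<^sub>R W (T t x))) = lam * (LINT x|lborel. f (U x) * V (T t x))"
    if t: "t \<ge> 1" for t
  proof (rule semilinear_identity)
    let ?S = "T t -` \<Omega>"
    show "open ?S" using open_\<Omega> contT by (simp add: continuous_on_open_vimage[OF open_UNIV, simplified])
    show "?S \<subseteq> \<Omega>" using T_in[OF t] by auto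
    show "continuous_on UNIV (\<lambda>x. V (T t x))"
      by (rule continuous_on_compose2[OF continuous_V contT]) simp
    show "V (T t x) > 0" if "x \<in> ?S" for x using V_pos that by simp
    show "V (T t x) = 0" if "x \<notin> ?S" for x using V_0 that by simp
    show "t *\<^sub>R W (T t x) = 0" if "x \<notin> ?S" for x using W_0 that by simp
    show "GDERIV (\<lambda>x. V (T t x)) x :> t *\<^sub>R W (T t x)" if "x \<in> ?S" for x
    proof -
      have "(T t has_derivative (\<lambda>h. t *\<^sub>R h)) (at x)"
        unfolding T_def by (auto intro!: derivative_eq_intros)
      then have "((\<lambda>x. V (T t x)) has_derivative (\<lambda>h. (t *\<^sub>R h) \<bullet> W (T t x))) (at x)"
        by (rule has_derivative_compose) (use GDERIV_V that in \<open>simp add: gderiv_def\<close>)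
      then show ?thesis by (simp add: gderiv_def)
    qed
    show "continuous_on ?S (\<lambda>x. t *\<^sub>R W (T t x))"
      by (intro continuous_intros continuous_on_compose2[OF continuous_on_W
            continuous_on_subset[OF contT]]) auto
    have "tame (\<lambda>x. W (T t x))" unfolding T_def by (rule tame_affine[OF tame_W]) (use t in simp)
    then show "tame (\<lambda>x. t *\<^sub>R W (T t x))" by (rule tame_cmult)
  qed
  have step: "lam * (LINT x|lborel. f (U x) * (V (T t x) - V x)) \<le> (t\<^sup>2 * inverse t ^ ?N - 1) / 2 * energy"
    if t: "t \<ge> 1" for t
  proof -
    have tW: "tame (\<lambda>x. W (T t x))" unfolding T_def by (rule tame_affine[OF tame_W]) (use t in simp)
    have tV: "tame (\<lambda>x. V (T t x))" unfolding T_def by (rule tame_affine[OF tame_V]) (use t in simp)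
    have tWt: "tame (\<lambda>x. t *\<^sub>R W (T t x))" by (rule tame_cmult[OF tW])
    note i1 = tame_integrable[OF tame_inner[OF tame_W tWt]]
      and i2 = tame_integrable[OF tame_norm_sq[OF tWt]]
      and i3 = tame_integrable[OF tame_norm_sq[OF tame_W]]
      and i4 = tame_integrable[OF tame_cont_mult[OF continuous_fU tV]]
      and i5 = tame_integrable[OF tame_cont_mult[OF continuous_fU tame_V]]
    have "(LINT x|lborel. (norm (t *\<^sub>R W (T t x)))\<^sup>2) = t\<^sup>2 * (LINT x|lborel. (norm (W (T t x)))\<^sup>2)"
      by (simp add: power_mult_distrib)
    also have "(LINT x|lborel. (norm (W (T t x)))\<^sup>2) = inverse t ^ ?N * energy"
      unfolding T_def energy_def
      using lborel_integral_affine[OF tame_measurable[OF tame_norm_sq[OF tame_W]], of t a a] t by simp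
    finally have scaled: "(LINT x|lborel. (norm (t *\<^sub>R W (T t x)))\<^sup>2) = t\<^sup>2 * inverse t ^ ?N * energy"
      by simp
    have "(LINT x|lborel. f (U x) * (V (T t x) - V x))
        = (LINT x|lborel. f (U x) * V (T t x)) - (LINT x|lborel. f (U x) * V x)"
      using i4 i5 by (simp add: right_diff_distrib)
    then have "lam * (LINT x|lborel. f (U x) * (V (T t x) - V x))
        = (LINT x|lborel. W x \<bullet> (t *\<^sub>R W (T t x))) - energy"
      unfolding dilate[OF t] energy_identity by (simp add: right_diff_distrib)
    also have "(LINT x|lborel. W x \<bullet> (t *\<^sub>R W (T t x)))
        \<le> (LINT x|lborel. ((norm (t *\<^sub>R W (T t x)))\<^sup>2 + (norm (W x))\<^sup>2) / 2)"
    proof (rule integral_mono[OF i1])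
      show "integrable lborel (\<lambda>x. ((norm (t *\<^sub>R W (T t x)))\<^sup>2 + (norm (W x))\<^sup>2) / 2)"
        using i2 i3 by (intro integrable_divide Bochner_Integration.integrable_add)
      show "W x \<bullet> (t *\<^sub>R W (T t x)) \<le> ((norm (t *\<^sub>R W (T t x)))\<^sup>2 + (norm (W x))\<^sup>2) / 2" for x
      proof -
        have "2 * (v \<bullet> w) \<le> (norm w)\<^sup>2 + (norm v)\<^sup>2" for v w :: 'a
          using zero_le_power2[of "norm (v - w)"]
          unfolding power2_norm_eq_inner by (simp add: inner_diff_left inner_diff_right inner_commute)
        from this[of "W x" "t *\<^sub>R W (T t x)"] show ?thesis by simp
      qed
    qed
    also have "(LINT x|lborel. ((norm (t *\<^sub>R W (T t x)))\<^sup>2 + (norm (W x))\<^sup>2) / 2)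
        = (t\<^sup>2 * inverse t ^ ?N * energy + energy) / 2"
      using i2 i3 scaled by (simp add: energy_def)
    finally show ?thesis by (simp add: algebra_simps)
  qed
  define h where "h n = inverse (real (Suc n))" for n
  have h: "h n > 0" "h n \<le> 1" for n by (simp_all add: h_def inverse_le_1_iff)
  have h0: "h \<longlonglongrightarrow> 0" unfolding h_def by (rule LIMSEQ_inverse_real_of_nat)
  \<comment> \<open>the error made by replacing \<open>f(U)\<close> times the increment of \<open>V\<close> by the increment of \<open>F(U)\<close>\<close>
  define R where "R n x = ((F (U (T (1 + h n) x)) - F (U x))
      - f (U x) * (V (T (1 + h n) x) - V x)) / h n" for n x
  have tFU: "tame (\<lambda>x. F (U (T (1 + h n) x)))" for n
    unfolding T_def by (rule tame_affine[OF tame_FU, of "1 + h n" a a]) (use h[of n] in simp)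
  have tVn: "tame (\<lambda>x. V (T (1 + h n) x))" for n
    unfolding T_def by (rule tame_affine[OF tame_V]) (use h[of n] in simp)
  have tR1: "tame (\<lambda>x. F (U (T (1 + h n) x)) - F (U x))" for n by (intro tame_diff tFU tame_FU)
  have tR2: "tame (\<lambda>x. f (U x) * (V (T (1 + h n) x) - V x))" for n
    by (intro tame_cont_mult continuous_fU tame_diff tVn tame_V)
  have "tame (\<lambda>x. inverse (h n) *\<^sub>R ((F (U (T (1 + h n) x)) - F (U x))
      - f (U x) * (V (T (1 + h n) x) - V x)))" for n
    by (intro tame_cmult tame_diff tR1 tR2)
  then have tR: "tame (R n)" for n
    unfolding R_def[abs_def] by (simp add: divide_inverse mult.commute)
  have R_off: "R n x = 0" if "x \<notin> \<Omega>" for n x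
  proof -
    have "T (1 + h n) x \<notin> \<Omega>" using T_in[of "1 + h n" x] h(1)[of n] that by auto
    then show ?thesis using that by (simp add: R_def U_def V_0)
  qed
  have R_lim: "(\<lambda>n. R n x) \<longlonglongrightarrow> 0" for x
  proof (cases "x \<in> \<Omega>")
    case False then show ?thesis by (simp add: R_off)
  next
    case True
    \<comment> \<open>With \<open>c\<close> frozen, \<open>F - c \<Theta>\<close> is stationary at \<open>U x\<close>, hence so is its composition with \<open>t \<mapsto> U (T t x)\<close>
      at \<open>t = 1\<close>.\<close>
    define c where "c = f (U x)"
    have Ux: "U x > 0" using True U_pos_iff by simp
    have "((\<lambda>s. F s - c * \<Theta> s) has_real_derivative (U x powr q - c * sqrt (\<theta> (U x)))) (at (U x))"
      by (intro DERIV_diff DERIV_cmult DERIV_F DERIV_\<Theta>) (use Ux in auto)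
    moreover have "U x powr q - c * sqrt (\<theta> (U x)) = 0"
      using \<theta>_pos[of "U x"] by (simp add: c_def f_def)
    ultimately have k: "((\<lambda>s. F s - c * \<Theta> s) has_real_derivative 0) (at (U x))" by simp
    have "GDERIV (\<lambda>y. F (U y) - c * \<Theta> (U y)) x :> 0 *\<^sub>R DU x"
      by (rule GDERIV_DERIV_compose[OF GDERIV_U[OF True] k])
    then have "GDERIV (\<lambda>y. F (U y) - c * \<Theta> (U y)) (T 1 x) :> 0" by (simp add: T_def)
    then have "((\<lambda>y. F (U y) - c * \<Theta> (U y)) has_derivative (\<lambda>h. 0)) (at (T 1 x))"
      by (simp add: gderiv_def)
    moreover have "((\<lambda>t. T t x) has_derivative (\<lambda>t. t *\<^sub>R (x - a))) (at 1)"
      unfolding T_def by (auto intro!: derivative_eq_intros)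
    ultimately have "((\<lambda>t. F (U (T t x)) - c * \<Theta> (U (T t x))) has_derivative (\<lambda>t. 0)) (at 1)"
      by (rule has_derivative_compose[rotated])
    then have "((\<lambda>t. F (U (T t x)) - c * \<Theta> (U (T t x))) has_real_derivative 0) (at 1)"
      by (simp add: has_field_derivative_def mult_zero_left[abs_def])
    from DERIV_at_1_sequence[OF this h0 h(1)]
    show ?thesis by (simp add: R_def V_def c_def T_def algebra_simps)
  qed
  obtain M where M: "\<And>x. U x \<le> M"
    using tame_bound[OF tame_U] abs_ge_self order_trans by (metis real_norm_def)
  obtain L where L: "L \<ge> 0" "\<And>x. norm (DU x) \<le> L" using DU_bounded by blast
  have M0: "M \<ge> 0" using M[of undefined] U_nonneg[of undefined] by linarith
  have "bounded ((\<lambda>s. sqrt (\<theta> s)) ` {0..M})"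
    by (intro compact_imp_bounded compact_continuous_image continuous_on_subset[OF continuous_sqrt_\<theta>]) auto
  then obtain CT where "\<forall>y\<in>(\<lambda>s. sqrt (\<theta> s)) ` {0..M}. norm y \<le> CT" unfolding bounded_iff by blast
  then have CT: "\<bar>sqrt (\<theta> s)\<bar> \<le> CT" if "0 < s" "s \<le> M" for s using that by simp
  have CF: "\<bar>s powr q\<bar> \<le> M powr q" if "0 < s" "s \<le> M" for s
    using that q_pos by (simp add: powr_mono2)
  have lipF: "\<bar>F (U x) - F (U y)\<bar> \<le> M powr q * \<bar>U x - U y\<bar>" for x y
    by (rule abs_diff_le_of_bounded_deriv[OF continuous_on_F DERIV_F CF]) (auto simp: U_nonneg M)
  have lipV: "\<bar>V x - V y\<bar> \<le> CT * \<bar>U x - U y\<bar>" for x y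
    unfolding V_def
    by (rule abs_diff_le_of_bounded_deriv[OF continuous_on_\<Theta> DERIV_\<Theta> CT]) (auto simp: U_nonneg M)
  have fb: "f (U x) \<le> M powr q" for x
  proof -
    have "U x powr q \<le> M powr q" using M U_nonneg q_pos by (intro powr_mono2) auto
    moreover have "sqrt (\<theta> (U x)) \<ge> 1" using \<theta>_ge_1 by simp
    then have "U x powr q / sqrt (\<theta> (U x)) \<le> U x powr q / 1"
      by (intro divide_left_mono) auto
    ultimately show ?thesis unfolding f_def by simp
  qed
  obtain r where r: "\<forall>x\<in>\<Omega>. norm x \<le> r" using bounded_\<Omega> unfolding bounded_iff by blast
  define B where "B = (M powr q + M powr q * \<bar>CT\<bar>) * (L * (r + norm a))"
  have Rb: "norm (R n x) \<le> \<bar>B\<bar>" for n x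
  proof (cases "x \<in> \<Omega>")
    case False then show ?thesis by (simp add: R_off)
  next
    case True
    let ?y = "T (1 + h n) x"
    have "norm (?y - x) = h n * norm (x - a)"
    proof -
      have "?y - x = h n *\<^sub>R (x - a)" by (simp add: T_def algebra_simps)
      then show ?thesis using h(1)[of n] by simp
    qed
    also have "\<dots> \<le> h n * (r + norm a)"
      using r True norm_triangle_ineq4[of x a] h(1)[of n] by (intro mult_left_mono) force+
    finally have "L * norm (?y - x) \<le> L * (h n * (r + norm a))" using L(1) by (rule mult_left_mono)
    then have dU: "\<bar>U ?y - U x\<bar> \<le> L * (h n * (r + norm a))"
      using U_lipschitz[OF L(2), of ?y x] by linarith
    have "\<bar>f (U x) * (V ?y - V x)\<bar> \<le> M powr q * (\<bar>CT\<bar> * \<bar>U ?y - U x\<bar>)"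
      unfolding abs_mult using fb[of x] fU_nonneg[of x] lipV[of ?y x]
      by (intro mult_mono order_trans[OF lipV mult_right_mono]) auto
    then have "\<bar>(F (U ?y) - F (U x)) - f (U x) * (V ?y - V x)\<bar>
        \<le> (M powr q + M powr q * \<bar>CT\<bar>) * \<bar>U ?y - U x\<bar>"
      using lipF[of ?y x] by (simp add: algebra_simps)
    also have "\<dots> \<le> (M powr q + M powr q * \<bar>CT\<bar>) * (L * (h n * (r + norm a)))"
      by (intro mult_left_mono dU) simp
    also have "\<dots> = B * h n" by (simp add: B_def)
    also have "\<dots> \<le> \<bar>B\<bar> * h n" using h(1)[of n] by (intro mult_right_mono) auto
    finally show ?thesis using h(1)[of n] by (simp add: R_def divide_le_eq)
  qed
  have "(\<lambda>n. LINT x|lborel. R n x) \<longlonglongrightarrow> (LINT x::'a|lborel. 0)"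
    by (rule tame_dominated_convergence[OF tame_measurable[OF tR] Rb bounded_\<Omega> R_off R_lim])
  then have IR: "(\<lambda>n. LINT x|lborel. R n x) \<longlonglongrightarrow> 0" by simp
  let ?I = "LINT x|lborel. F (U x)"
  define p where "p t = inverse t ^ ?N" for t :: real
  have dp: "(p has_real_derivative - real ?N) (at 1)"
    unfolding p_def[abs_def] by (auto intro!: derivative_eq_intros)
  have dq: "((\<lambda>t. t\<^sup>2 * p t) has_real_derivative 2 - real ?N) (at 1)"
    by (rule derivative_eq_intros dp refl)+ (simp add: p_def)
  note lp = DERIV_at_1_sequence[OF dp h0 h(1)] and lq = DERIV_at_1_sequence[OF dq h0 h(1)]
  have ineq: "lam * ((p (1 + h n) - p 1) / h n * ?I - (LINT x|lborel. R n x))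
      \<le> ((1 + h n)\<^sup>2 * p (1 + h n) - 1\<^sup>2 * p 1) / h n / 2 * energy" for n
  proof -
    let ?J = "LINT x|lborel. f (U x) * (V (T (1 + h n) x) - V x)"
    have "(LINT x|lborel. F (U (T (1 + h n) x))) = p (1 + h n) * ?I"
      unfolding T_def p_def
      using lborel_integral_affine[OF tame_measurable[OF tame_FU], of "1 + h n" a a] h(1)[of n] by simp
    then have "(LINT x|lborel. F (U (T (1 + h n) x)) - F (U x)) = p (1 + h n) * ?I - p 1 * ?I"
      using tame_integrable[OF tFU] tame_integrable[OF tame_FU] by (simp add: p_def)
    then have "(LINT x|lborel. R n x) = ((p (1 + h n) * ?I - p 1 * ?I) - ?J) / h n"
      unfolding R_def using tame_integrable[OF tR1[of n]] tame_integrable[OF tR2[of n]] by simp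
    then have "(p (1 + h n) - p 1) / h n * ?I - (LINT x|lborel. R n x) = ?J / h n"
      by (simp add: diff_divide_distrib left_diff_distrib)
    moreover have "lam * ?J / h n \<le> ((1 + h n)\<^sup>2 * inverse (1 + h n) ^ ?N - 1) / 2 * energy / h n"
      using step[of "1 + h n"] h(1)[of n] by (intro divide_right_mono) auto
    ultimately show ?thesis by (simp add: p_def mult.commute)
  qed
  have "lam * ((- real ?N) * ?I - 0) \<le> (2 - real ?N) / 2 * energy"
  proof (rule LIMSEQ_le)
    show "(\<lambda>n. lam * ((p (1 + h n) - p 1) / h n * ?I - (LINT x|lborel. R n x)))
        \<longlonglongrightarrow> lam * ((- real ?N) * ?I - 0)"
      by (intro tendsto_intros lp IR)
    show "(\<lambda>n. ((1 + h n)\<^sup>2 * p (1 + h n) - 1\<^sup>2 * p 1) / h n / 2 * energy)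
        \<longlonglongrightarrow> (2 - real ?N) / 2 * energy"
      by (intro tendsto_intros lq) simp
    show "\<exists>n0. \<forall>n\<ge>n0. lam * ((p (1 + h n) - p 1) / h n * ?I - (LINT x|lborel. R n x))
      \<le> ((1 + h n)\<^sup>2 * p (1 + h n) - 1\<^sup>2 * p 1) / h n / 2 * energy"
      using ineq by blast
  qed
  then show ?thesis by (simp add: algebra_simps)
qed

end

section \<open>Nonexistence\<close>

context positive_weak_solution
begin

text \<open>The difference of the two sides has derivative \<open>(2 \<theta> - s \<theta>') / (4 sqrt \<theta>)\<close>. It is nonnegative because
\<open>\<theta> s / s\<^sup>2\<close> is nonincreasing, and strictly positive at zero because \<open>\<theta> 0 > 0\<close>; the latter makes the inequality
strict, which is what the borderline exponent requires.\<close>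

lemma \<Theta>_gt_half:
  assumes anti: "antimono_on {0<..} (\<lambda>s. \<theta> s / s\<^sup>2)" and s: "s > 0"
  shows "s * sqrt (\<theta> s) / 2 < \<Theta> s"
proof -
  define g where "g s = \<Theta> s - s * sqrt (\<theta> s) / 2" for s
  define g' where "g' s = (2 * \<theta> s - s * deriv \<theta> s) / (4 * sqrt (\<theta> s))" for s
  have g: "(g has_real_derivative g' s) (at s)" if "s \<ge> 0" for s
  proof -
    have "((\<lambda>s. sqrt (\<theta> s)) has_real_derivative deriv \<theta> s * (inverse (sqrt (\<theta> s)) / 2)) (at s)"
      using DERIV_real_sqrt[OF \<theta>_pos[of s]] DERIV_\<theta>[of s]
      by (metis DERIV_chain2 mult.commute)
    then have "((\<lambda>s. s * sqrt (\<theta> s) / 2) has_real_derivative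
        (1 * sqrt (\<theta> s) + deriv \<theta> s * (inverse (sqrt (\<theta> s)) / 2) * s) / 2) (at s)"
      by (intro DERIV_cdivide DERIV_mult DERIV_ident)
    from DERIV_diff[OF DERIV_\<Theta>[OF that] this]
    have "(g has_real_derivative sqrt (\<theta> s)
        - (1 * sqrt (\<theta> s) + deriv \<theta> s * (inverse (sqrt (\<theta> s)) / 2) * s) / 2) (at s)"
      unfolding g_def[abs_def] .
    moreover have "sqrt (\<theta> s) - (1 * sqrt (\<theta> s) + deriv \<theta> s * (inverse (sqrt (\<theta> s)) / 2) * s) / 2 = g' s"
    proof -
      define c where "c = sqrt (\<theta> s)"
      have "c > 0" "\<theta> s = c * c" using \<theta>_pos[of s] by (auto simp: c_def)
      then show ?thesis unfolding g'_def c_def[symmetric] by (simp add: field_simps)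
    qed
    ultimately show ?thesis by simp
  qed
  have g'_nonneg: "g' s \<ge> 0" if "s > 0" for s
  proof -
    have "((\<lambda>s. - (\<theta> s / s\<^sup>2)) has_real_derivative
        - ((deriv \<theta> s * s\<^sup>2 - \<theta> s * (2 * s)) / (s\<^sup>2 * s\<^sup>2))) (at s)"
      using that by (auto intro!: derivative_eq_intros DERIV_\<theta>)
    moreover have "mono_on {0<..} (\<lambda>s. - (\<theta> s / s\<^sup>2))"
      using anti by (auto simp: monotone_on_def)
    ultimately have "- ((deriv \<theta> s * s\<^sup>2 - \<theta> s * (2 * s)) / (s\<^sup>2 * s\<^sup>2)) \<ge> 0"
      using that by (intro mono_on_imp_deriv_nonneg[of "{0<..}"]) (auto simp: interior_open)
    then have "deriv \<theta> s * s\<^sup>2 - \<theta> s * (2 * s) \<le> 0"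
      using that by (simp add: divide_le_0_iff zero_le_divide_iff)
    then have "s * (s * deriv \<theta> s - 2 * \<theta> s) \<le> 0" by (simp add: algebra_simps power2_eq_square)
    then have "s * deriv \<theta> s \<le> 2 * \<theta> s" using that by (simp add: mult_le_0_iff)
    then show ?thesis unfolding g'_def using \<theta>_pos[of s] by simp
  qed
  have "g' 0 > 0" using \<theta>_pos[of 0] by (simp add: g'_def)
  from DERIV_pos_inc_right[OF g[OF order_refl] this]
  obtain d where d: "d > 0" "\<forall>h>0. h < d \<longrightarrow> g 0 < g (0 + h)" by blast
  define h where "h = min (d / 2) s"
  have h: "0 < h" "h < d" "h \<le> s" using d(1) s by (auto simp: h_def)
  have "0 < g h" using d(2) h \<Theta>_0 by (auto simp: g_def)
  also have "g h \<le> g s"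
  proof (rule DERIV_nonneg_imp_nondecreasing[OF h(3)])
    fix x assume "h \<le> x" "x \<le> s"
    then show "\<exists>y. (g has_real_derivative y) (at x) \<and> 0 \<le> y"
      using g[of x] g'_nonneg[of x] h(1) by (intro exI[of _ "g' x"]) simp
  qed
  finally show ?thesis by (simp add: g_def)
qed

text \<open>If the energy vanished, \<open>U\<close> would have zero gradient, hence be constant on the whole space by the
Lipschitz bound, although it is positive in \<open>\<Omega>\<close> and zero outside.\<close>

lemma energy_pos: "energy > 0"
proof (rule ccontr)
  assume "\<not> energy > 0"
  have W0: "W x = 0" for x
  proof (rule ccontr)
    assume "W x \<noteq> 0"
    then have x: "x \<in> \<Omega> \<inter> W -` (- {0})" using W_0 by auto
    have "energy > 0"
      unfolding energy_def
    proof (rule integral_pos_on_open)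
      show "integrable lborel (\<lambda>x. (norm (W x))\<^sup>2)" by (rule tame_integrable[OF tame_norm_sq[OF tame_W]])
      show "open (\<Omega> \<inter> W -` (- {0}))"
        by (rule continuous_open_preimage[OF continuous_on_W open_\<Omega>]) (simp add: open_Compl)
      show "\<Omega> \<inter> W -` (- {0}) \<noteq> {}" using x by blast
    qed auto
    with \<open>\<not> energy > 0\<close> show False by simp
  qed
  have "DU x = 0" for x
    using W0[of x] \<theta>_pos[of "U x"] by (simp add: W_def)
  then have const: "U x = U y" for x y
    using U_lipschitz[of 0 x y] by simp
  obtain x where "x \<in> \<Omega>" using nonempty_\<Omega> by blast
  moreover obtain y where "y \<notin> \<Omega>"
    using bounded_\<Omega> not_bounded_UNIV by (metis UNIV_eq_I)
  ultimately show False using const[of x y] U_pos_iff[of x] by (simp add: U_def)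
qed

text \<open>The energy identity forces \<open>lam > 0\<close>. Substituting it into the Pohozaev inequality, the integral of
\<open>g = (N - 2) / 2 f(U) V - N F(U)\<close> is at most zero, whereas the bound on \<open>\<Theta>\<close> and the lower bound on \<open>q\<close> make
\<open>g\<close> positive in \<open>\<Omega>\<close>.\<close>

theorem no_positive_weak_solution:
  assumes N: "DIM('a) \<ge> 3" and star: "starlike \<Omega>"
    and anti: "antimono_on {0<..} (\<lambda>s. \<theta> s / s\<^sup>2)"
    and q: "q \<ge> 2 * critical_exponent (DIM('a)) - 1"
  shows False
proof -
  let ?N = "real DIM('a)"
  have N3: "?N \<ge> 3" using N by simp
  obtain a where "\<And>x. x \<in> \<Omega> \<Longrightarrow> closed_segment a x \<subseteq> \<Omega>"
    using star unfolding starlike_def by blast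
  then have poh: "(?N - 2) / 2 * energy \<le> ?N * lam * (LINT x|lborel. F (U x))"
    by (rule pohozaev_inequality)
  have tfV: "tame (\<lambda>x. f (U x) * V x)" by (rule tame_cont_mult[OF continuous_fU tame_V])
  have V0: "V x \<ge> 0" for x using V_pos[of x] V_0[of x] by (cases "x \<in> \<Omega>") auto
  have "(LINT x|lborel. f (U x) * V x) \<ge> 0"
    using fU_nonneg V0 by (intro integral_nonneg_AE AE_I2) simp
  then have lam: "lam > 0"
    using energy_pos energy_identity by (metis mult_nonpos_nonneg not_less)
  define g where "g x = (?N - 2) / 2 * (f (U x) * V x) - ?N * F (U x)" for x
  have gpos: "g x > 0" if "x \<in> \<Omega>" for x
  proof -
    define s where "s = U x"
    have s: "s > 0" using that U_pos_iff by (simp add: s_def)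
    have c: "sqrt (\<theta> s) > 0" using \<theta>_pos by simp
    \<comment> \<open>the condition on \<open>q\<close>: the factor \<open>1/2\<close> in the bound on \<open>\<Theta>\<close> is what doubles the critical exponent\<close>
    have q1: "q + 1 \<ge> 4 * ?N / (?N - 2)" using q by (simp add: critical_exponent_def)
    have "?N / (q + 1) \<le> (?N - 2) / 4"
      using q1 N3 q_pos by (simp add: field_simps)
    then have "?N * F s \<le> (?N - 2) / 4 * s powr (q + 1)"
      using mult_right_mono[of "?N / (q + 1)" "(?N - 2) / 4" "s powr (q + 1)"] by (simp add: F_def)
    also have "\<dots> = (?N - 2) / 2 * (f s * (s * sqrt (\<theta> s) / 2))"
      using c s by (simp add: f_def powr_add)
    also have "\<dots> < (?N - 2) / 2 * (f s * \<Theta> s)"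
      using \<Theta>_gt_half[OF anti s] N3 c s by (intro mult_strict_left_mono) (auto simp: f_def)
    finally show ?thesis by (simp add: g_def V_def s_def)
  qed
  have g0: "g x \<ge> 0" for x
    using gpos[of x] by (cases "x \<in> \<Omega>") (auto simp: g_def V_0 U_def F_0)
  note i1 = tame_integrable[OF tfV] and i2 = tame_integrable[OF tame_FU]
  have "integrable lborel g" unfolding g_def[abs_def] using i1 i2 by simp
  from integral_pos_on_open[OF this g0 open_\<Omega> nonempty_\<Omega> gpos]
  have "lam * (LINT x|lborel. g x) > 0" using lam by simp
  moreover have "lam * (LINT x|lborel. g x) = (?N - 2) / 2 * energy - ?N * lam * (LINT x|lborel. F (U x))"
    unfolding g_def energy_identity using i1 i2 by (simp add: right_diff_distrib)
  ultimately show False using poh by linarith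
qed

end

theorem theorem1p6:
  fixes \<Omega> :: "(real ^ 'n) set" and \<theta> :: "real \<Rightarrow> real" and \<alpha> q :: real
  assumes "CARD('n) \<ge> 3"
    and "bounded \<Omega>" and "smooth_domain \<Omega>" and "starlike \<Omega>"
    and "\<forall>s. \<theta> s \<ge> 1"
    and "\<forall>s. \<theta> (- s) = \<theta> s"
    and "\<theta> C1_differentiable_on UNIV"
    and "strict_antimono_on {..<0} \<theta>" and "strict_mono_on {0<..} \<theta>"
    and "mono_on {..<0} (\<lambda>s. \<theta> s / s\<^sup>2)" and "antimono_on {0<..} (\<lambda>s. \<theta> s / s\<^sup>2)"
    and "\<alpha> > 0" and "((\<lambda>s. \<theta> s / s\<^sup>2) \<longlongrightarrow> \<alpha>\<^sup>2 / 2) at_infinity"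
    and "q \<ge> 2 * critical_exponent CARD('n) - 1"
  shows "\<forall>lam::real. \<not> (\<exists>u. weak_solution \<theta> q lam \<Omega> u \<and> positive_in \<Omega> u)"
proof (intro allI notI, elim exE conjE)
  fix lam u
  assume u: "weak_solution \<theta> q lam \<Omega> u" "positive_in \<Omega> u"
  have "critical_exponent CARD('n) \<ge> 1"
    using assms(1) by (simp add: critical_exponent_def field_simps)
  then have "q > 0" using assms(14) by linarith
  interpret positive_weak_solution \<Omega> \<theta> q lam u
    using assms(2,3,5,7) u \<open>q > 0\<close>
    by unfold_locales (auto simp: smooth_domain_def)
  show False
    using no_positive_weak_solution assms(1,4,11,14) by simp
qed

end
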